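(* Let $\tau\in T_{\mathbb C}$ be such that $W_\tau\neq W_{(\tau)}$. Then $I_\tau$ is reducible (as a ${}^{BL}\mathcal H_{\mathbb C}$-module).
   Context: Let $\mathcal S=(A,X,Y,(\alpha_i)_{i\in I},(\alpha_i^\vee)_{i\in I})$ be a root generating system: $A=(a_{i,j})$ is a Kac–Moody matrix (finite index set $I$, integer entries, $a_{i,i}=2$, $a_{i,j}\le 0$ for $i\ne j$, $a_{i,j}=0\iff a_{j,i}=0$), $X,Y$ are dual free $\mathbb Z$-modules of finite rank, $(\alpha_i)$ and $(\alpha_i^\vee)$ are free families in $X$ and $Y$ with $\alpha_j(\alpha_i^\vee)=a_{i,j}$. Put $\mathbb A=Y\otimes\mathbb R$, $r_i(v)=v-\alpha_i(v)\alpha_i^\vee$, $\mathscr S=\{r_i\}$, $W^v=\langle\mathscr S\rangle\subset GL(\mathbb A)$ (Coxeter group with length $\ell$); for $s=r_i$ write $\alpha_s=\alpha_i$, $\alpha_s^\vee=\alpha_i^\vee$. $\Phi^\vee=\{w.\alpha_s^\vee\mid w\in W^v,s\in\mathscr S\}$; for $\alpha^\vee=w.\alpha_s^\vee$, $r_{\alpha^\vee}=wsw^{-1}$. $(\sigma_s)_{s\in\mathscr S},(\sigma'_s)_{s\in\mathscr S}$ are families in $\mathbb C^*$ such that $\sigma_s=\sigma'_s$ if $\alpha_s(Y)=\mathbb Z$, and $\sigma_s=\sigma_t=\sigma'_s=\sigma'_t$ for $s\ne t$ with $st$ of finite odd order. Standing assumption: $\sigma'_s\notin\{\sigma_s^{-1},-\sigma_s,-\sigma_s^{-1}\}$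 for all $s\in\mathscr S$. ${}^{BL}\mathcal H_{\mathbb C}$ is the $\mathbb C$-vector space with basis $(Z^\lambda H_w)_{\lambda\in Y,w\in W^v}$ ($Z^\lambda=Z^\lambda H_1$, $H_w=Z^0H_w$) with the unique associative product such that $Z^\lambda*H_w=Z^\lambda H_w$; $Z^\lambda*Z^\mu=Z^{\lambda+\mu}$; $H_s*H_w=H_{sw}$ if $\ell(sw)=\ell(w)+1$ and $H_s*H_w=(\sigma_s-\sigma_s^{-1})H_w+H_{sw}$ if $\ell(sw)=\ell(w)-1$; and $H_s*Z^\lambda-Z^{s.\lambda}*H_s=Q_s(Z)(Z^\lambda-Z^{s.\lambda})$ with $Q_s(Z)=\frac{(\sigma_s-\sigma_s^{-1})+(\sigma_s'-\sigma_s'^{-1})Z^{-\alpha_s^\vee}}{1-Z^{-2\alpha_s^\vee}}$. $\mathbb C[Y]=\bigoplus_\lambda\mathbb CZ^\lambda$, with fraction field $\mathbb C(Y)$; $W^v$ acts on both by $(Z^\lambda)^w=Z^{w.\lambda}$. $T_{\mathbb C}=\mathrm{Hom}_{\mathrm{Gr}}(Y,\mathbb C^* )$, with $(w.\tau)(\lambda)=\tau(w^{-1}.\lambda)$; $\tau$ is extended to an algebra morphism $\mathbb C[Y]\to\mathbb C$; $I_\tau={}^{BL}\mathcal H_{\mathbb C}\otimes_{\mathbb C[Y]}\mathbb C$, $\mathbb C[Y]$ acting on $\mathbb C$ via $\tau$. $W_\tau=\{w\in W^v\mid w.\tau=\tau\}$. For $s\in\mathscr S$, $\zeta_s=-\sigma_sQ_s(Z)+\sigma_s^2\in\mathbb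 C(Y)$; for $\alpha^\vee=w.\alpha_s^\vee\in\Phi^\vee$, $\zeta_{\alpha^\vee}=(\zeta_s)^w=\zeta^{\mathrm{num}}_{\alpha^\vee}/\zeta^{\mathrm{den}}_{\alpha^\vee}$ with coprime numerator and denominator in the UFD $\mathbb C[Y]$. $W_{(\tau)}=\langle r_{\alpha^\vee}\mid\alpha^\vee\in\Phi^\vee,\ \tau(\zeta^{\mathrm{den}}_{\alpha^\vee})=0\rangle\subset W_\tau$. *)

theory Defs
  imports Complex_Main "HOL-Library.Poly_Mapping" "HOL-Library.Set_Algebras"
    "HOL-Computational_Algebra.Fraction_Field"
begin

section \<open>Free abelian groups of finite rank\<close>

context ab_group_add
begin

definition zscale :: "int \<Rightarrow> 'a \<Rightarrow> 'a" (infixr \<open>\<cdot>\<^sub>\<int>\<close> 75)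
  where "n \<cdot>\<^sub>\<int> x = (if 0 \<le> n then ((+) x ^^ nat n) 0 else - ((+) x ^^ nat (- n)) 0)"

end

lemma zscale_0: "0 \<cdot>\<^sub>\<int> x = 0"
  by (simp add: zscale_def)

lemma zscale_succ: "(n + 1) \<cdot>\<^sub>\<int> x = x + n \<cdot>\<^sub>\<int> x"
proof (cases "0 \<le> n")
  case True
  then show ?thesis by (simp add: zscale_def nat_add_distrib)
next
  case False
  then have "nat (- n) = Suc (nat (- (n + 1)))" by simp
  with False show ?thesis by (cases "n = - 1") (simp_all add: zscale_def)
qed

lemma zscale_pred: "(n - 1) \<cdot>\<^sub>\<int> x = n \<cdot>\<^sub>\<int> x - x"
  using zscale_succ[of "n - 1" x] by (simp add: algebra_simps)

global_interpretation zmod: module zscale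
proof
  fix a b :: int and x y :: 'a
  show "a \<cdot>\<^sub>\<int> (x + y) = a \<cdot>\<^sub>\<int> x + a \<cdot>\<^sub>\<int> y"
    by (induction a rule: int_induct[where k = 0])
      (simp_all add: zscale_0 zscale_succ zscale_pred algebra_simps)
  show add: "(a + b) \<cdot>\<^sub>\<int> x = a \<cdot>\<^sub>\<int> x + b \<cdot>\<^sub>\<int> x" for a b and x :: 'a
  proof (induction a rule: int_induct[where k = 0])
    case (step1 i)
    have "(i + 1 + b) \<cdot>\<^sub>\<int> x = (i + b + 1) \<cdot>\<^sub>\<int> x" by (simp add: algebra_simps)
    then show ?case using step1 by (simp add: zscale_succ)
  next
    case (step2 i)
    have "(i - 1 + b) \<cdot>\<^sub>\<int> x = (i + b - 1) \<cdot>\<^sub>\<int> x" by (simp add: algebra_simps)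
    then show ?case using step2 by (simp add: zscale_pred algebra_simps)
  qed (simp add: zscale_0)
  have minus: "(- b) \<cdot>\<^sub>\<int> x = - (b \<cdot>\<^sub>\<int> x)" for b and x :: 'a
    using add[of b "- b" x] by (simp add: zscale_0 eq_neg_iff_add_eq_0 add.commute)
  show one: "1 \<cdot>\<^sub>\<int> x = x" for x :: 'a
    using zscale_succ[of 0 x] by (simp add: zscale_0)
  show "a \<cdot>\<^sub>\<int> (b \<cdot>\<^sub>\<int> x) = (a * b) \<cdot>\<^sub>\<int> x"
    by (induction a rule: int_induct[where k = 0])
      (simp_all add: zscale_0 zscale_succ zscale_pred add minus one left_diff_distrib distrib_right
        diff_conv_add_uminus del: add_uminus_conv_diff)
qed

class free_ab_group_fin_rank = ab_group_add +
  assumes ex_finite_zbasis: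
    "\<exists>B. finite B \<and> (\<forall>x. \<exists>!c. (\<forall>b. b \<notin> B \<longrightarrow> c b = 0) \<and> x = (\<Sum>b\<in>B. c b \<cdot>\<^sub>\<int> b))"


section \<open>The group algebra and its field of fractions\<close>

text \<open>
  The group algebra \<open>\<complex>[Y]\<close> is a copy of \<^typ>\<open>'y \<Rightarrow>\<^sub>0 complex\<close>. The copy is needed
  because the library makes the latter an integral domain for ordered groups only, while
  \<open>Y\<close> carries no order here.
\<close>

typedef (overloaded) 'y group_algebra = "UNIV :: ('y \<Rightarrow>\<^sub>0 complex) set"
  morphisms coeffs Group_Algebra ..

setup_lifting type_definition_group_algebra

instantiation group_algebra :: (ab_group_add) comm_ring_1
begin
lift_definition zero_group_algebra :: "'a group_algebra" is 0 .
lift_definition one_group_algebra :: "'a group_algebra" is 1 .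
lift_definition plus_group_algebra :: "'a group_algebra \<Rightarrow> 'a group_algebra \<Rightarrow> 'a group_algebra"
  is "(+)" .
lift_definition minus_group_algebra :: "'a group_algebra \<Rightarrow> 'a group_algebra \<Rightarrow> 'a group_algebra"
  is "(-)" .
lift_definition uminus_group_algebra :: "'a group_algebra \<Rightarrow> 'a group_algebra" is uminus .
lift_definition times_group_algebra :: "'a group_algebra \<Rightarrow> 'a group_algebra \<Rightarrow> 'a group_algebra"
  is "(*)" .
instance by standard (transfer, simp add: algebra_simps)+
end

text \<open>\<open>monomial a \<nu>\<close> is \<open>a Z\<^sup>\<nu>\<close>.\<close>
lift_definition monomial :: "complex \<Rightarrow> 'y \<Rightarrow> 'y group_algebra"
  is "\<lambda>a \<nu>. Poly_Mapping.single \<nu> a" .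

definition coeff :: "'y group_algebra \<Rightarrow> 'y \<Rightarrow> complex"
  where "coeff f \<nu> = Poly_Mapping.lookup (coeffs f) \<nu>"

definition support :: "'y group_algebra \<Rightarrow> 'y set"
  where "support f = Poly_Mapping.keys (coeffs f)"

text \<open>No zero divisors: \<open>Y\<close> embeds into the ordered group of finitely supported integer sequences.\<close>

definition push :: "('a \<Rightarrow> 'b) \<Rightarrow> ('a \<Rightarrow>\<^sub>0 complex) \<Rightarrow> ('b \<Rightarrow>\<^sub>0 complex)"
  where "push e f = (\<Sum>k\<in>Poly_Mapping.keys f. Poly_Mapping.single (e k) (Poly_Mapping.lookup f k))"

lemma push_superset:
  assumes "finite K" "Poly_Mapping.keys f \<subseteq> K"
  shows "push e f = (\<Sum>k\<in>K. Poly_Mapping.single (e k) (Poly_Mapping.lookup f k))"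
  unfolding push_def using assms
  by (intro sum.mono_neutral_left) (auto simp: in_keys_iff)

lemma push_add: "push e (f + g) = push e f + push e g"
proof -
  let ?K = "Poly_Mapping.keys f \<union> Poly_Mapping.keys g"
  have "push e h = (\<Sum>k\<in>?K. Poly_Mapping.single (e k) (Poly_Mapping.lookup h k))" if "Poly_Mapping.keys h \<subseteq> ?K" for h
    using that by (intro push_superset) auto
  then show ?thesis
    using Poly_Mapping.keys_add[of f g] by (simp add: lookup_add single_add sum.distrib)
qed

lemma push_single: "push e (Poly_Mapping.single k a) = Poly_Mapping.single (e k) a"
  by (cases "a = 0") (simp_all add: push_def)

lemma poly_mapping_single_induct:
  fixes f :: "'a \<Rightarrow>\<^sub>0 complex"
  assumes "P 0" "\<And>k a. P (Poly_Mapping.single k a)" "\<And>f g. P f \<Longrightarrow> P g \<Longrightarrow> P (f + g)"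
  shows "P f"
proof -
  have "P (\<Sum>k\<in>K. Poly_Mapping.single k (Poly_Mapping.lookup f k))" if "finite K" for K
    using that by (induction K) (use assms in auto)
  moreover have "f = (\<Sum>k\<in>Poly_Mapping.keys f. Poly_Mapping.single k (Poly_Mapping.lookup f k))"
    by (rule poly_mapping_eqI)
      (auto simp: lookup_sum lookup_single when_def sum.delta in_keys_iff)
  ultimately show ?thesis by (metis finite_keys)
qed

lemma push_mult:
  assumes "\<And>x y. e (x + y) = e x + e y"
  shows "push e (f * g) = push e f * push e g"
proof (induction f rule: poly_mapping_single_induct)
  case (2 k a)
  show ?case
  proof (induction g rule: poly_mapping_single_induct)
    case (2 l b)
    then show ?case by (simp add: mult_single push_single assms)
  qed (simp_all add: push_def[of _ 0] push_add algebra_simps)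
qed (simp_all add: push_def[of _ 0] push_add algebra_simps)

lemma push_eq_0:
  assumes "inj e" "push e f = 0"
  shows "f = 0"
proof (rule poly_mapping_eqI)
  fix k
  have "Poly_Mapping.lookup (push e f) (e k) = (\<Sum>l\<in>Poly_Mapping.keys f. if l = k then Poly_Mapping.lookup f k else 0)"
    using assms(1) unfolding push_def lookup_sum
    by (intro sum.cong) (auto simp: lookup_single when_def inj_eq)
  then show "Poly_Mapping.lookup f k = Poly_Mapping.lookup 0 k"
    using assms(2) by (auto simp: sum.delta in_keys_iff split: if_splits)
qed

lemma ex_ordered_embedding:
  "\<exists>e :: 'y::free_ab_group_fin_rank \<Rightarrow> (nat \<Rightarrow>\<^sub>0 int). inj e \<and> (\<forall>x y. e (x + y) = e x + e y)"
proof -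
  obtain B :: "'y set" where fB: "finite B"
    and ex1: "\<And>x. \<exists>!c. (\<forall>b. b \<notin> B \<longrightarrow> c b = 0) \<and> x = (\<Sum>b\<in>B. c b \<cdot>\<^sub>\<int> b)"
    using ex_finite_zbasis by blast
  define r where "r x = (THE c. (\<forall>b. b \<notin> B \<longrightarrow> c b = 0) \<and> x = (\<Sum>b\<in>B. c b \<cdot>\<^sub>\<int> b))" for x
  have r: "(\<forall>b. b \<notin> B \<longrightarrow> r x b = 0) \<and> x = (\<Sum>b\<in>B. r x b \<cdot>\<^sub>\<int> b)" for x
    unfolding r_def by (rule theI'[OF ex1])
  have r_add: "r (x + y) = (\<lambda>b. r x b + r y b)" for x y
  proof -
    have "(\<forall>b. b \<notin> B \<longrightarrow> r x b + r y b = 0) \<and> x + y = (\<Sum>b\<in>B. (r x b + r y b) \<cdot>\<^sub>\<int> b)"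
      using r[of x] r[of y] by (simp add: zmod.scale_left_distrib sum.distrib)
    then show ?thesis unfolding r_def[of "x + y"] by (rule the1_equality[OF ex1])
  qed
  obtain n and b :: "nat \<Rightarrow> 'y" where b: "B = b ` {i. i < n}" "inj_on b {i. i < n}"
    using finite_imp_nat_seg_image_inj_on[OF fB] by metis
  define c where "c y i = (if i < n then r y (b i) else 0)" for y i
  have fin: "finite {i. c y i \<noteq> 0}" for y
    by (rule finite_subset[of _ "{..<n}"]) (auto simp: c_def split: if_splits)
  define e where "e y = Abs_poly_mapping (c y)" for y
  have e: "Poly_Mapping.lookup (e y) = c y" for y
    using fin by (simp add: e_def)
  have "e (x + y) = e x + e y" for x y
    by (intro poly_mapping_eqI) (simp add: lookup_add e c_def r_add)
  moreover have "inj e"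
  proof (rule injI)
    fix x y assume "e x = e y"
    then have "c x = c y" using e by metis
    then have "r x v = r y v" if "v \<in> B" for v
      using that b(1) unfolding c_def by (auto simp: fun_eq_iff) metis
    then have "(\<Sum>v\<in>B. r x v \<cdot>\<^sub>\<int> v) = (\<Sum>v\<in>B. r y v \<cdot>\<^sub>\<int> v)" by (intro sum.cong) auto
    then show "x = y" using r[of x] r[of y] by metis
  qed
  ultimately show ?thesis by blast
qed

instance group_algebra :: (free_ab_group_fin_rank) idom
proof
  fix f g :: "'a group_algebra"
  assume fg: "f \<noteq> 0" "g \<noteq> 0"
  obtain e :: "'a \<Rightarrow> (nat \<Rightarrow>\<^sub>0 int)" where e: "inj e" "\<And>x y. e (x + y) = e x + e y"
    using ex_ordered_embedding by blast
  show "f * g \<noteq> 0"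
    using fg
  proof transfer
    fix f g :: "'a \<Rightarrow>\<^sub>0 complex"
    assume "f \<noteq> 0" "g \<noteq> 0"
    then have "push e (f * g) \<noteq> 0"
      using push_eq_0[OF e(1)] by (auto simp: push_mult[OF e(2)])
    then show "f * g \<noteq> 0" by (auto simp: push_def)
  qed
qed

text \<open>Exact division, which makes the library's \<^term>\<open>coprime\<close> available.\<close>

instantiation group_algebra :: (free_ab_group_fin_rank) idom_divide
begin
definition divide_group_algebra :: "'a group_algebra \<Rightarrow> 'a group_algebra \<Rightarrow> 'a group_algebra"
  where "divide_group_algebra f g = (if g \<noteq> 0 \<and> g dvd f then THE q. f = q * g else 0)"
instance by standard (auto simp: divide_group_algebra_def)
end

instance group_algebra :: (free_ab_group_fin_rank) algebraic_semidom ..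

type_synonym 'y rational_functions = "'y group_algebra fract"

definition algebra_act :: "('y \<Rightarrow> 'y) \<Rightarrow> 'y::ab_group_add group_algebra \<Rightarrow> 'y group_algebra"
  where "algebra_act w f = (\<Sum>\<nu>\<in>support f. monomial (coeff f \<nu>) (w \<nu>))"

text \<open>The extension to fractions; meaningful for injective additive \<open>w\<close> only.\<close>
definition fract_act ::
    "('y \<Rightarrow> 'y) \<Rightarrow> 'y::free_ab_group_fin_rank rational_functions \<Rightarrow> 'y rational_functions"
  where "fract_act w q =
    (THE r. \<forall>n d. d \<noteq> 0 \<longrightarrow> q = Fract n d \<longrightarrow> r = Fract (algebra_act w n) (algebra_act w d))"

definition torus :: "('y::ab_group_add \<Rightarrow> complex) set"
  where "torus = {\<tau>. (\<forall>\<nu>. \<tau> \<nu> \<noteq> 0) \<and> (\<forall>\<nu> \<mu>. \<tau> (\<nu> + \<mu>) = \<tau> \<nu> * \<tau> \<mu>)}"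

definition eval_at :: "('y \<Rightarrow> complex) \<Rightarrow> 'y group_algebra \<Rightarrow> complex"
  where "eval_at \<tau> f = (\<Sum>\<nu>\<in>support f. coeff f \<nu> * \<tau> \<nu>)"


section \<open>Root generating systems\<close>

record ('i, 'x, 'y) root_datum =
  index_set :: "'i set"
  cartan :: "'i \<Rightarrow> 'i \<Rightarrow> int"
  pairing :: "'x \<Rightarrow> 'y \<Rightarrow> int"
  root :: "'i \<Rightarrow> 'x"
  coroot :: "'i \<Rightarrow> 'y"

text \<open>
  The perfect pairing identifies \<open>X\<close> with \<open>Hom(Y, \<int>)\<close>; as \<open>Y\<close> is free of finite rank, it then
  also identifies \<open>Y\<close> with \<open>Hom(X, \<int>)\<close>.
\<close>

locale root_generating_system =
  fixes S :: "('i, 'x::free_ab_group_fin_rank, 'y::free_ab_group_fin_rank) root_datum"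
  assumes finite_index: "finite (index_set S)"
    and cartan_diag: "i \<in> index_set S \<Longrightarrow> cartan S i i = 2"
    and cartan_nonpos:
      "i \<in> index_set S \<Longrightarrow> j \<in> index_set S \<Longrightarrow> i \<noteq> j \<Longrightarrow> cartan S i j \<le> 0"
    and cartan_zero:
      "i \<in> index_set S \<Longrightarrow> j \<in> index_set S \<Longrightarrow> cartan S i j = 0 \<longleftrightarrow> cartan S j i = 0"
    and pairing_additive_left: "additive (\<lambda>x. pairing S x y)"
    and pairing_additive_right: "additive (pairing S x)"
    and pairing_perfect: "additive f \<Longrightarrow> \<exists>!x. f = pairing S x"
    and roots_free: "inj_on (root S) (index_set S)" "zmod.independent (root S ` index_set S)"
    and coroots_free: "inj_on (coroot S) (index_set S)" "zmod.independent (coroot S ` index_set S)"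
    and pairing_cartan:
      "i \<in> index_set S \<Longrightarrow> j \<in> index_set S \<Longrightarrow> pairing S (root S j) (coroot S i) = cartan S i j"

text \<open>
  \<open>Y\<close> spans \<open>Y \<otimes> \<real>\<close>, and the simple reflections preserve \<open>Y\<close>. The Weyl group is therefore
  represented by its faithful action on \<open>Y\<close>.
\<close>

definition refl :: "('i, 'x, 'y::ab_group_add) root_datum \<Rightarrow> 'i \<Rightarrow> 'y \<Rightarrow> 'y"
  where "refl S i v = v - pairing S (root S i) v \<cdot>\<^sub>\<int> coroot S i"

inductive_set generated_group :: "('a \<Rightarrow> 'a) set \<Rightarrow> ('a \<Rightarrow> 'a) set" for G
  where
    gen_id: "id \<in> generated_group G"
  | gen_base: "g \<in> G \<Longrightarrow> g \<in> generated_group G"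
  | gen_comp: "f \<in> generated_group G \<Longrightarrow> g \<in> generated_group G \<Longrightarrow> f \<circ> g \<in> generated_group G"
  | gen_inv: "f \<in> generated_group G \<Longrightarrow> inv f \<in> generated_group G"

definition weyl :: "('i, 'x, 'y::ab_group_add) root_datum \<Rightarrow> ('y \<Rightarrow> 'y) set"
  where "weyl S = generated_group (refl S ` index_set S)"

definition weyl_length :: "('i, 'x, 'y::ab_group_add) root_datum \<Rightarrow> ('y \<Rightarrow> 'y) \<Rightarrow> nat"
  where "weyl_length S w =
    (LEAST n. \<exists>js. set js \<subseteq> index_set S \<and> length js = n \<and> w = foldr (\<lambda>i v. refl S i \<circ> v) js id)"

definition coroots :: "('i, 'x, 'y::ab_group_add) root_datum \<Rightarrow> 'y set"
  where "coroots S = {w (coroot S i) | w i. w \<in> weyl S \<and> i \<in> index_set S}"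

text \<open>The order of a permutation, with value \<open>0\<close> (which is even) for infinite order.\<close>
definition perm_order :: "('a \<Rightarrow> 'a) \<Rightarrow> nat"
  where "perm_order f = (if \<exists>n>0. f ^^ n = id then LEAST n. n > 0 \<and> f ^^ n = id else 0)"

text \<open>
  Parameters are indexed by \<open>I\<close>; \<open>i \<mapsto> r\<^sub>i\<close> is a bijection from \<open>I\<close> onto the set of simple
  reflections.
\<close>

locale hecke_parameters = root_generating_system S
  for S :: "('i, 'x::free_ab_group_fin_rank, 'y::free_ab_group_fin_rank) root_datum" +
  fixes \<sigma> \<sigma>' :: "'i \<Rightarrow> complex"
  assumes sigma_nonzero: "i \<in> index_set S \<Longrightarrow> \<sigma> i \<noteq> 0" "i \<in> index_set S \<Longrightarrow> \<sigma>' i \<noteq> 0"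
    and sigma_eq: "i \<in> index_set S \<Longrightarrow> range (pairing S (root S i)) = UNIV \<Longrightarrow> \<sigma> i = \<sigma>' i"
    and sigma_odd:
      "i \<in> index_set S \<Longrightarrow> j \<in> index_set S \<Longrightarrow> i \<noteq> j \<Longrightarrow> odd (perm_order (refl S i \<circ> refl S j))
        \<Longrightarrow> \<sigma> i = \<sigma> j \<and> \<sigma> j = \<sigma>' i \<and> \<sigma>' i = \<sigma>' j"
    and sigma_generic:
      "i \<in> index_set S \<Longrightarrow> \<sigma>' i \<notin> {inverse (\<sigma> i), - \<sigma> i, - inverse (\<sigma> i)}"

definition Q_fraction :: "('i, 'x, 'y::free_ab_group_fin_rank) root_datum
    \<Rightarrow> ('i \<Rightarrow> complex) \<Rightarrow> ('i \<Rightarrow> complex) \<Rightarrow> 'i \<Rightarrow> 'y rational_functions"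
  where "Q_fraction S \<sigma> \<sigma>' i =
    Fract (monomial (\<sigma> i - inverse (\<sigma> i)) 0
           + monomial (\<sigma>' i - inverse (\<sigma>' i)) (- coroot S i))
          (1 - monomial 1 (- (2 \<cdot>\<^sub>\<int> coroot S i)))"

definition zeta_simple :: "('i, 'x, 'y::free_ab_group_fin_rank) root_datum
    \<Rightarrow> ('i \<Rightarrow> complex) \<Rightarrow> ('i \<Rightarrow> complex) \<Rightarrow> 'i \<Rightarrow> 'y rational_functions"
  where "zeta_simple S \<sigma> \<sigma>' i =
    - Fract (monomial (\<sigma> i) 0) 1 * Q_fraction S \<sigma> \<sigma>' i + Fract (monomial ((\<sigma> i)\<^sup>2) 0) 1"

definition torus_act :: "('y \<Rightarrow> 'y) \<Rightarrow> ('y \<Rightarrow> complex) \<Rightarrow> ('y \<Rightarrow> complex)"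
  where "torus_act w \<tau> = (\<lambda>\<nu>. \<tau> (inv w \<nu>))"

definition weyl_stabilizer ::
    "('i, 'x, 'y::ab_group_add) root_datum \<Rightarrow> ('y \<Rightarrow> complex) \<Rightarrow> ('y \<Rightarrow> 'y) set"
  where "weyl_stabilizer S \<tau> = {w \<in> weyl S. torus_act w \<tau> = \<tau>}"

text \<open>
  Neither the reflection nor the fraction attached to \<open>w.\<alpha>\<^sub>i\<^sup>\<or>\<close> depends on the choice of \<open>(w, i)\<close>,
  and reduced fractions are unique up to units of the group algebra, at which \<open>\<tau>\<close> does not
  vanish. Quantifying existentially over the choices is therefore harmless.
\<close>

definition zeta_den_vanishes :: "('y \<Rightarrow> complex) \<Rightarrow> 'y::free_ab_group_fin_rank rational_functions \<Rightarrow> bool"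
  where "zeta_den_vanishes \<tau> z \<longleftrightarrow>
    (\<exists>num den. den \<noteq> 0 \<and> coprime num den \<and> z = Fract num den \<and> eval_at \<tau> den = 0)"

definition reflection_subgroup :: "('i, 'x, 'y::free_ab_group_fin_rank) root_datum
    \<Rightarrow> ('i \<Rightarrow> complex) \<Rightarrow> ('i \<Rightarrow> complex) \<Rightarrow> ('y \<Rightarrow> complex) \<Rightarrow> ('y \<Rightarrow> 'y) set"
  where "reflection_subgroup S \<sigma> \<sigma>' \<tau> = generated_group
    {w \<circ> refl S i \<circ> inv w | a w i.
       a \<in> coroots S \<and> w \<in> weyl S \<and> i \<in> index_set S \<and> a = w (coroot S i) \<and>
       zeta_den_vanishes \<tau> (fract_act w (zeta_simple S \<sigma> \<sigma>' i))}"


section \<open>The Bernstein--Lusztig--Hecke algebra\<close>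

text \<open>
  \<open>ZH \<nu> w\<close> is the basis vector \<open>Z\<^sup>\<nu> H\<^sub>w\<close>; for \<open>w\<close> outside the Weyl group its value is irrelevant.
\<close>

definition algebra_embed :: "(complex \<Rightarrow> 'h::ring_1 \<Rightarrow> 'h) \<Rightarrow> ('y \<Rightarrow> ('y \<Rightarrow> 'y) \<Rightarrow> 'h)
    \<Rightarrow> 'y group_algebra \<Rightarrow> 'h"
  where "algebra_embed scale ZH f = (\<Sum>\<nu>\<in>support f. scale (coeff f \<nu>) (ZH \<nu> id))"

text \<open>
  The product is determined by these relations, so that any two instances of the locale with the
  same data are canonically isomorphic. In \<open>bernstein\<close>, the right-hand side of the relation is a
  priori in the field of fractions but lies in the group algebra; \<open>f\<close> is that element. The relations
  make \<open>Z\<^sup>0 H\<^sub>1\<close> a left unit, so it is the unit of \<^typ>\<open>'h\<close>.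
\<close>

locale bernstein_lusztig_hecke =
  hecke_parameters S \<sigma> \<sigma>' + vector_space scale
  for S :: "('i, 'x::free_ab_group_fin_rank, 'y::free_ab_group_fin_rank) root_datum"
    and \<sigma> \<sigma>' :: "'i \<Rightarrow> complex"
    and scale :: "complex \<Rightarrow> 'h::ring_1 \<Rightarrow> 'h" +
  fixes ZH :: "'y \<Rightarrow> ('y \<Rightarrow> 'y) \<Rightarrow> 'h"
  assumes mult_scale_left: "scale c x * y = scale c (x * y)"
    and mult_scale_right: "x * scale c y = scale c (x * y)"
    and basis_inj: "inj_on (\<lambda>(\<nu>, w). ZH \<nu> w) (UNIV \<times> weyl S)"
    and basis_independent: "independent ((\<lambda>(\<nu>, w). ZH \<nu> w) ` (UNIV \<times> weyl S))"
    and basis_span: "span ((\<lambda>(\<nu>, w). ZH \<nu> w) ` (UNIV \<times> weyl S)) = UNIV"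
    and Z_mult_H: "w \<in> weyl S \<Longrightarrow> ZH \<nu> id * ZH 0 w = ZH \<nu> w"
    and Z_mult_Z: "ZH \<nu> id * ZH \<mu> id = ZH (\<nu> + \<mu>) id"
    and H_mult_up: "i \<in> index_set S \<Longrightarrow> w \<in> weyl S \<Longrightarrow>
      weyl_length S (refl S i \<circ> w) = weyl_length S w + 1 \<Longrightarrow>
      ZH 0 (refl S i) * ZH 0 w = ZH 0 (refl S i \<circ> w)"
    and H_mult_down: "i \<in> index_set S \<Longrightarrow> w \<in> weyl S \<Longrightarrow>
      weyl_length S (refl S i \<circ> w) + 1 = weyl_length S w \<Longrightarrow>
      ZH 0 (refl S i) * ZH 0 w
        = scale (\<sigma> i - inverse (\<sigma> i)) (ZH 0 w) + ZH 0 (refl S i \<circ> w)"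
    and bernstein: "i \<in> index_set S \<Longrightarrow>
      \<exists>f. Fract f 1 = Q_fraction S \<sigma> \<sigma>' i * Fract (monomial 1 \<nu> - monomial 1 (refl S i \<nu>)) 1 \<and>
          ZH 0 (refl S i) * ZH \<nu> id - ZH (refl S i \<nu>) id * ZH 0 (refl S i)
            = algebra_embed scale ZH f"


section \<open>Principal series\<close>

text \<open>
  The tensor product of \<open>\<H>\<close> (right module over the group algebra) with \<open>\<complex>\<close> (left module through
  \<open>\<tau>\<close>): the free abelian group on \<open>\<H> \<times> \<complex>\<close> modulo the subgroup of balancing relations. Its elements
  are cosets, added as sets.
\<close>

definition tensor_relations :: "(complex \<Rightarrow> 'h::ring_1 \<Rightarrow> 'h) \<Rightarrow> ('y \<Rightarrow> ('y \<Rightarrow> 'y) \<Rightarrow> 'h)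
    \<Rightarrow> ('y \<Rightarrow> complex) \<Rightarrow> (('h \<times> complex) \<Rightarrow>\<^sub>0 int) set"
  where "tensor_relations scale ZH \<tau> = zmod.span (
      {frag_of (x + x', c) - frag_of (x, c) - frag_of (x', c) | x x' c. True}
    \<union> {frag_of (x, c + c') - frag_of (x, c) - frag_of (x, c') | x c c'. True}
    \<union> {frag_of (x * algebra_embed scale ZH f, c) - frag_of (x, eval_at \<tau> f * c) | x f c. True})"

definition principal_series :: "(complex \<Rightarrow> 'h::ring_1 \<Rightarrow> 'h) \<Rightarrow> ('y \<Rightarrow> ('y \<Rightarrow> 'y) \<Rightarrow> 'h)
    \<Rightarrow> ('y \<Rightarrow> complex) \<Rightarrow> (('h \<times> complex) \<Rightarrow>\<^sub>0 int) set set"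
  where "principal_series scale ZH \<tau> = range (\<lambda>u. u +o tensor_relations scale ZH \<tau>)"

text \<open>The action \<open>h.(x \<otimes> c) = hx \<otimes> c\<close>.\<close>
definition principal_series_act :: "(complex \<Rightarrow> 'h::ring_1 \<Rightarrow> 'h) \<Rightarrow> ('y \<Rightarrow> ('y \<Rightarrow> 'y) \<Rightarrow> 'h)
    \<Rightarrow> ('y \<Rightarrow> complex) \<Rightarrow> 'h \<Rightarrow> (('h \<times> complex) \<Rightarrow>\<^sub>0 int) set \<Rightarrow> (('h \<times> complex) \<Rightarrow>\<^sub>0 int) set"
  where "principal_series_act scale ZH \<tau> h A =
    frag_extend (\<lambda>(x, c). frag_of (h * x, c)) ` A + tensor_relations scale ZH \<tau>"

text \<open>
  Submodules of a left module with carrier \<open>M\<close>, zero \<open>z\<close>, addition \<open>add\<close> and action \<open>act\<close> of the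
  whole type \<^typ>\<open>'h\<close>. Closure under negation follows from the action of \<open>-1\<close>.
\<close>
definition submodule_of ::
    "'m set \<Rightarrow> 'm \<Rightarrow> ('m \<Rightarrow> 'm \<Rightarrow> 'm) \<Rightarrow> ('h::ring_1 \<Rightarrow> 'm \<Rightarrow> 'm) \<Rightarrow> 'm set \<Rightarrow> bool"
  where "submodule_of M z add act N \<longleftrightarrow> N \<subseteq> M \<and> z \<in> N \<and>
    (\<forall>a\<in>N. \<forall>b\<in>N. add a b \<in> N) \<and> (\<forall>h. \<forall>a\<in>N. act h a \<in> N)"

definition reducible_module ::
    "'m set \<Rightarrow> 'm \<Rightarrow> ('m \<Rightarrow> 'm \<Rightarrow> 'm) \<Rightarrow> ('h::ring_1 \<Rightarrow> 'm \<Rightarrow> 'm) \<Rightarrow> bool"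
  where "reducible_module M z add act \<longleftrightarrow> (\<exists>N. submodule_of M z add act N \<and> N \<noteq> {z} \<and> N \<noteq> M)"

end

theory Submission
  imports Defs "HOL-Computational_Algebra.Fundamental_Theorem_Algebra"
    "HOL-Analysis.Continuum_Not_Denumerable" "Jordan_Normal_Form.Determinant"
begin

unbundle no m_inv_syntax

text \<open>
  The module \<open>I\<^sub>\<tau>\<close> is the quotient of the algebra by the left ideal \<open>J\<close> generated by the \<open>Z\<^sup>\<kappa> - \<tau>(\<kappa>)\<close>. A
  word \<open>s\<^sub>1 \<dots> s\<^sub>k\<close> of minimal length for an element \<open>w\<close> of \<open>W\<^sub>\<tau>\<close> outside \<open>W\<^sub>(\<^sub>\<tau>\<^sub>)\<close> meets no pole of the
  functions \<open>Q\<^sub>s\<close>, so that the product of the factors \<open>H\<^sub>s - Q\<^sub>s\<close>, evaluated at the successive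
  weights, is an element \<open>v\<close> of weight \<open>w.\<tau> = \<tau>\<close> with leading term \<open>H\<^sub>w\<close>. Right multiplication by \<open>v\<close>
  is then a nonscalar endomorphism of \<open>I\<^sub>\<tau>\<close>, which Schur's lemma excludes for a simple module of
  countable dimension over \<open>\<complex>\<close>.
\<close>

section \<open>A Schur lemma in countable dimension\<close>

text \<open>The group \<open>W\<close> may be infinite, so that an endomorphism of
  \<open>I_\<tau>\<close> need not have an eigenvalue; this is why the contradiction is drawn from
  the uncountability of the complex numbers. Two further obstacles shape the proof. That
  \<open>v\<close> is not scalar modulo \<open>J\<close> is read off the coefficient of
  \<open>H_w\<close>, which presupposes that the classes of the \<open>H_w\<close> stay independent
  in \<open>I_\<tau>\<close>. But \<open>J\<close> is generated by factors standing on the right,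
  while the given basis has its powers of \<open>Z\<close> on the left; the two orders are compared
  through the length filtration. Moreover, \<open>W_(\<tau>)\<close> is defined by reduced
  denominators of the \<open>\<zeta>\<close>, whereas the construction of \<open>v\<close> must
  avoid poles of the \<open>Q_s\<close>. An explicit factorization of \<open>\<zeta>\<close> turns
  both into one condition on the value of \<open>\<tau>\<close> at a coroot; the standing assumption
  on \<open>\<sigma>'\<close> rules out any cancellation that would spoil this.\<close>

locale complex_algebra = vector_space scale
  for scale :: "complex \<Rightarrow> 'h::ring_1 \<Rightarrow> 'h" +
  assumes mult_scale_left: "scale c x * y = scale c (x * y)"
    and mult_scale_right: "x * scale c y = scale c (x * y)"
begin

definition left_ideal :: "'h set \<Rightarrow> bool"
  where "left_ideal J \<longleftrightarrow> 0 \<in> J \<and> (\<forall>x\<in>J. \<forall>y\<in>J. x + y \<in> J) \<and> (\<forall>h. \<forall>x\<in>J. h * x \<in> J)"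

text \<open>Scaling is left multiplication by \<open>scale c 1\<close>.\<close>

lemma left_ideal_scale: "left_ideal J \<Longrightarrow> x \<in> J \<Longrightarrow> scale c x \<in> J"
  using mult_scale_left[of c 1 x] unfolding left_ideal_def by (metis mult_1)

lemma left_ideal_diff: "left_ideal J \<Longrightarrow> x \<in> J \<Longrightarrow> y \<in> J \<Longrightarrow> x - y \<in> J"
  using left_ideal_scale[of J y "- 1"] unfolding left_ideal_def
  by (metis add_uminus_conv_diff scale_minus_left scale_one)

lemma left_ideal_sum: "left_ideal J \<Longrightarrow> (\<And>a. a \<in> A \<Longrightarrow> f a \<in> J) \<Longrightarrow> sum f A \<in> J"
  by (induction A rule: infinite_finite_induct) (auto simp: left_ideal_def)

lemma left_ideal_one: "left_ideal J \<Longrightarrow> 1 \<in> J \<Longrightarrow> J = UNIV"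
  unfolding left_ideal_def by (metis UNIV_eq_I mult.right_neutral)

text \<open>Evaluation of a complex polynomial at \<open>v\<close>; \<^const>\<open>poly\<close> is not available over \<^typ>\<open>'h\<close>.\<close>
definition poly_at :: "'h \<Rightarrow> complex poly \<Rightarrow> 'h"
  where "poly_at v p = fold_coeffs (\<lambda>a x. scale a 1 + x * v) p 0"

lemma poly_at_0 [simp]: "poly_at v 0 = 0"
  by (simp add: poly_at_def)

lemma poly_at_pCons [simp]: "poly_at v (pCons a p) = scale a 1 + poly_at v p * v"
  by (cases "p = 0 \<and> a = 0") (auto simp: poly_at_def)

lemma poly_at_add: "poly_at v (p + q) = poly_at v p + poly_at v q"
  by (induction p q rule: poly_induct2) (simp_all add: algebra_simps scale_left_distrib)

lemma poly_at_smult: "poly_at v (Polynomial.smult a p) = scale a (poly_at v p)"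
  by (induction p) (simp_all add: algebra_simps scale_right_distrib mult_scale_left)

lemma poly_at_commute: "poly_at v p * v = v * poly_at v p"
  by (induction p) (simp_all add: algebra_simps mult_scale_left mult_scale_right)

lemma poly_at_mult: "poly_at v (p * q) = poly_at v p * poly_at v q"
proof (induction p)
  case (pCons a p)
  have "poly_at v (pCons a p * q) = scale a (poly_at v q) + poly_at v p * (poly_at v q * v)"
    by (simp add: poly_at_add poly_at_smult pCons.IH mult.assoc)
  also have "\<dots> = poly_at v (pCons a p) * poly_at v q"
    by (simp add: poly_at_commute[symmetric] distrib_right mult_scale_left mult.assoc)
  finally show ?case .
qed simp

lemma poly_at_sum: "poly_at v (sum f A) = (\<Sum>a\<in>A. poly_at v (f a))"
  by (induction A rule: infinite_finite_induct) (simp_all add: poly_at_add)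

text \<open>Enumerate \<open>B\<close>. Every element of \<open>A\<close> lies in the span of an
  initial segment, and the span of \<open>n\<close> vectors contains at most \<open>n\<close>
  independent ones, so \<open>A\<close> is a countable union of finite sets.\<close>

lemma countable_independent_in_countable_span:
  assumes "countable B" "independent A" "A \<subseteq> span B"
  shows "countable A"
proof (cases "B = {}")
  case True
  then have "A \<subseteq> {0}" using assms(3) by simp
  then show ?thesis by (meson countable_empty countable_insert countable_subset)
next
  case False
  then obtain b :: "nat \<Rightarrow> 'h" where b: "B = range b"
    using assms(1) by (metis range_from_nat_into)
  have "A \<subseteq> (\<Union>n. A \<inter> span (b ` {..<n}))"
  proof
    fix x assume x: "x \<in> A"
    then have "x \<in> span B" using assms(3) by auto
    then obtain t r where t: "finite t" "t \<subseteq> B" and r: "x = (\<Sum>a\<in>t. scale (r a) a)"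
      unfolding span_explicit by blast
    have "x \<in> span t"
      unfolding r by (intro span_sum span_scale span_base)
    obtain C where C: "finite C" "t = b ` C"
      using finite_subset_image[OF t(1), of b UNIV] t(2) b by blast
    then obtain n where "C \<subseteq> {..<n}" using finite_nat_iff_bounded by auto
    then have "x \<in> span (b ` {..<n})" using \<open>x \<in> span t\<close> C(2) span_mono[of t "b ` {..<n}"] by auto
    with x show "x \<in> (\<Union>n. A \<inter> span (b ` {..<n}))" by auto
  qed
  moreover have "finite (A \<inter> span (b ` {..<n}))" for n
    using independent_span_bound[of "b ` {..<n}" "A \<inter> span (b ` {..<n})"]
      independent_mono[OF assms(2)] by simp
  then have "countable (\<Union>n. A \<inter> span (b ` {..<n}))"
    by (intro countable_UN countableI_type countable_finite)
  ultimately show ?thesis by (rule countable_subset)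
qed

text \<open>
  If \<open>J\<close> were maximal, then right multiplication by each \<open>v - c\<close> would be bijective on the quotient
  by \<open>J\<close>, and the uncountably many inverses \<open>y c\<close> would be linearly independent: a relation between
  them, multiplied by the product of the factors \<open>v - c\<close>, yields a nonzero polynomial
  annihilating \<open>1\<close> modulo \<open>J\<close>, which splits into linear factors.
\<close>
theorem not_maximal_if_nonscalar_endomorphism:
  assumes J: "left_ideal J" and B: "countable B" "span B = UNIV"
    and Jv: "\<And>x. x \<in> J \<Longrightarrow> x * v \<in> J"
    and v: "\<And>c. v - scale c 1 \<notin> J"
  shows "\<exists>L. left_ideal L \<and> J \<subset> L \<and> L \<noteq> UNIV"
proof (rule ccontr)
  assume "\<not> ?thesis"
  then have maxJ: "L = J" if "left_ideal L" "J \<subseteq> L" "L \<noteq> UNIV" for L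
    using that by blast
  have one: "1 \<notin> J"
    using left_ideal_one[OF J] v by auto
  \<comment> \<open>\<open>J\<close> is only a left ideal; that it absorbs polynomials in
    \<open>v\<close> from the right rests on \<open>Jv\<close>.\<close>
  have Jp: "x * poly_at v p \<in> J" if "x \<in> J" for x p
  proof (induction p)
    case 0
    then show ?case using J by (simp add: left_ideal_def)
  next
    case (pCons a p)
    have "x * poly_at v (pCons a p) = scale a x + x * poly_at v p * v"
      by (simp add: distrib_left mult_scale_right mult.assoc)
    then show ?case
      using Jv[OF pCons.IH] left_ideal_scale[OF J that] J by (auto simp: left_ideal_def)
  qed
  have lin: "poly_at v [:- c, 1:] = v - scale c 1" for c
    by simp
  \<comment> \<open>Injectivity on the quotient: the kernel is a left ideal containing
    \<open>J\<close>, and it is proper because \<open>v - c\<close> is not in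
    \<open>J\<close>.\<close>
  have cancel: "x \<in> J" if "x * (v - scale c 1) \<in> J" for x c
  proof -
    let ?K = "{x. x * (v - scale c 1) \<in> J}"
    have "left_ideal ?K"
      using J by (auto simp: left_ideal_def distrib_right mult.assoc)
    moreover have "J \<subseteq> ?K"
      using Jp[of _ "[:- c, 1:]"] lin by auto
    moreover have "1 \<notin> ?K" using v by simp
    ultimately have "?K = J" using maxJ by blast
    with that show ?thesis by blast
  qed
  have no_poly: "p = 0" if "poly_at v p \<in> J" for p
    using that
  proof (induction "degree p" arbitrary: p)
    case 0
    then obtain a where a: "p = [:a:]" using degree_0_id by metis
    show ?case
    proof (rule ccontr)
      assume "p \<noteq> 0"
      then have "scale (inverse a) (poly_at v p) = 1" using a by simp
      then show False using left_ideal_scale[OF J 0(2), of "inverse a"] one by simp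
    qed
  next
    case (Suc n)
    then have "\<not> constant (poly p)"
      by (simp add: constant_degree)
    then obtain d where "poly p d = 0"
      using fundamental_theorem_of_algebra by blast
    then obtain q where q: "p = [:- d, 1:] * q"
      by (auto simp: poly_eq_0_iff_dvd)
    then have "q \<noteq> 0" using Suc(2) by auto
    then have "degree p = Suc (degree q)"
      using q degree_mult_eq[of "[:- d, 1:]" q] by simp
    \<comment> \<open>The root factor is moved to the right, the side on which \<open>cancel\<close>
      works.\<close>
    moreover have "poly_at v p = poly_at v q * (v - scale d 1)"
      unfolding q by (subst mult.commute) (simp only: poly_at_mult lin)
    ultimately have "q = 0" using Suc.hyps(1)[of q] Suc.hyps(2) Suc.prems cancel by simp
    with \<open>q \<noteq> 0\<close> show ?case by simp
  qed
  \<comment> \<open>Surjectivity on the quotient: the left multiples of \<open>v - c\<close>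
    together with \<open>J\<close> form a left ideal that contains \<open>v - c\<close>, hence
    exceeds \<open>J\<close> and contains \<open>1\<close>.\<close>
  have "\<exists>y. y * (v - scale c 1) - 1 \<in> J" for c
  proof -
    let ?L = "{h * (v - scale c 1) + x | h x. x \<in> J}"
    have "left_ideal ?L"
      unfolding left_ideal_def
    proof (intro conjI ballI allI)
      show "0 \<in> ?L" using J by (auto simp: left_ideal_def intro!: exI[of _ 0])
      show "a + b \<in> ?L" if "a \<in> ?L" "b \<in> ?L" for a b
      proof -
        obtain h x h' x' where "a = h * (v - scale c 1) + x" "b = h' * (v - scale c 1) + x'" "x \<in> J" "x' \<in> J"
          using \<open>a \<in> ?L\<close> \<open>b \<in> ?L\<close> by blast
        then have "a + b = (h + h') * (v - scale c 1) + (x + x')" "x + x' \<in> J"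
          using J by (simp_all add: left_ideal_def distrib_right add_ac)
        then show ?thesis by blast
      qed
      show "g * a \<in> ?L" if "a \<in> ?L" for g a
      proof -
        obtain h x where "a = h * (v - scale c 1) + x" "x \<in> J" using \<open>a \<in> ?L\<close> by blast
        then have "g * a = g * h * (v - scale c 1) + g * x" "g * x \<in> J"
          using J by (auto simp: left_ideal_def distrib_left mult.assoc)
        then show ?thesis by blast
      qed
    qed
    moreover have "J \<subseteq> ?L"
    proof
      fix x assume "x \<in> J"
      then have "x = 0 * (v - scale c 1) + x \<and> x \<in> J" by simp
      then show "x \<in> ?L" by blast
    qed
    moreover have "?L \<noteq> J"
    proof -
      have "v - scale c 1 = 1 * (v - scale c 1) + 0 \<and> 0 \<in> J"
        using J by (simp add: left_ideal_def)
      then have "v - scale c 1 \<in> ?L" by blast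
      then show ?thesis using v by blast
    qed
    ultimately have "?L = UNIV" using maxJ by blast
    then have "1 \<in> ?L" by simp
    then obtain h x where "1 = h * (v - scale c 1) + x" "x \<in> J" by blast
    then have "h * (v - scale c 1) - 1 = - x" by (simp add: algebra_simps)
    moreover have "- x \<in> J"
      using left_ideal_diff[OF J _ \<open>x \<in> J\<close>, of 0] J by (simp add: left_ideal_def)
    ultimately show ?thesis by metis
  qed
  then obtain y where y: "y c * (v - scale c 1) - 1 \<in> J" for c by metis
  have relation: "\<forall>c\<in>C. a c = 0" if C: "finite C" and rel: "(\<Sum>c\<in>C. scale (a c) (y c)) = 0" for C a
  proof -
    define P where "P c = (\<Prod>d\<in>C - {c}. [:- d, 1:])" for c
    let ?p = "\<Prod>d\<in>C. [:- d, 1::complex:]"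
    have "y c * poly_at v ?p - poly_at v (P c) \<in> J" if "c \<in> C" for c
    proof -
      \<comment> \<open>The factor belonging to \<open>c\<close> is taken out on the left, next to
        \<open>y c\<close>, with which it gives \<open>1\<close> modulo \<open>J\<close>; the
        remaining factor multiplies from the right, as \<open>Jp\<close> permits.\<close>
      have "?p = [:- c, 1:] * P c"
        using C that by (simp add: P_def prod.remove)
      then have "y c * poly_at v ?p - poly_at v (P c) = (y c * (v - scale c 1) - 1) * poly_at v (P c)"
        by (simp only: poly_at_mult lin) (simp add: algebra_simps)
      then show ?thesis using Jp[OF y] by simp
    qed
    then have "(\<Sum>c\<in>C. scale (a c) (y c * poly_at v ?p - poly_at v (P c))) \<in> J"
      by (intro left_ideal_sum[OF J] left_ideal_scale[OF J])
    also have "(\<Sum>c\<in>C. scale (a c) (y c * poly_at v ?p - poly_at v (P c)))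
        = (\<Sum>c\<in>C. scale (a c) (y c)) * poly_at v ?p - poly_at v (\<Sum>c\<in>C. Polynomial.smult (a c) (P c))"
      by (simp add: scale_right_diff_distrib sum_subtractf poly_at_sum poly_at_smult
          sum_distrib_right mult_scale_left)
    finally have "0 - poly_at v (\<Sum>c\<in>C. Polynomial.smult (a c) (P c)) \<in> J"
      using rel by simp
    then have "poly_at v (\<Sum>c\<in>C. Polynomial.smult (a c) (P c)) \<in> J"
      using left_ideal_diff[OF J, of 0] J by (force simp: left_ideal_def)
    then have z: "(\<Sum>c\<in>C. Polynomial.smult (a c) (P c)) = 0" by (rule no_poly)
    show ?thesis
    proof
      fix c assume c: "c \<in> C"
      \<comment> \<open>The \<open>P d\<close> are unnormalized Lagrange polynomials: at the point
        \<open>c\<close> only the term of index \<open>c\<close> survives.\<close>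
      have "poly (P d) c = 0" if "d \<in> C - {c}" for d
        unfolding P_def poly_prod using C c that by (intro prod_zero) auto
      then have "poly (\<Sum>d\<in>C. Polynomial.smult (a d) (P d)) c = a c * poly (P c) c"
        using C c by (simp add: poly_sum sum.remove)
      moreover have "poly (P c) c \<noteq> 0"
        using C by (simp add: P_def poly_prod)
      ultimately show "a c = 0" using z by simp
    qed
  qed
  have inj: "inj y"
  proof (rule injI, rule ccontr)
    fix c d assume cd: "y c = y d" "c \<noteq> d"
    then have "(\<Sum>e\<in>{c, d}. scale (if e = c then 1 else - 1) (y e)) = 0" by simp
    from relation[OF _ this] show False by simp
  qed
  have "independent (range y)"
    unfolding independent_explicit_module
  proof (intro allI impI)
    fix t u x
    assume t: "finite t" "t \<subseteq> range y" "(\<Sum>x\<in>t. scale (u x) x) = 0" "x \<in> t"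
    obtain C where C: "finite C" "t = y ` C"
      using finite_subset_image[OF t(1) t(2)] by blast
    then have "(\<Sum>c\<in>C. scale (u (y c)) (y c)) = 0"
      using t(3) inj by (simp add: sum.reindex inj_on_subset)
    from relation[OF C(1) this] show "u x = 0" using t(4) C(2) by auto
  qed
  then have "countable (range y)"
    using countable_independent_in_countable_span B by simp
  then have "countable (UNIV :: complex set)"
    using countable_image_inj_on inj by blast
  then show False using uncountable_UNIV_complex by simp
qed

section \<open>Submodules of the principal series\<close>

text \<open>
  A left ideal \<open>L\<close> between \<open>J\<close> and the algebra gives the submodule of the tensors \<open>\<Sum> x \<otimes> c\<close> with
  \<open>\<Sum> c x \<in> L\<close>.
\<close>
definition contract :: "('h \<times> complex \<Rightarrow>\<^sub>0 int) \<Rightarrow> 'h"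
  where "contract u =
    (\<Sum>k\<in>Poly_Mapping.keys u. of_int (Poly_Mapping.lookup u k) * scale (snd k) (fst k))"

end

text \<open>The supports of \<open>f\<close>, \<open>g\<close> and \<open>f + g\<close> differ, so
  the three sums are extended to one index set, where the added terms vanish. This serves both
  contractions of tensors and sums over supports in the group algebra.\<close>

lemma sum_keys_add:
  fixes F :: "'a \<Rightarrow> 'b::comm_monoid_add \<Rightarrow> 'c::comm_monoid_add"
  assumes "\<And>a. F a 0 = 0" "\<And>a x y. F a (x + y) = F a x + F a y"
  shows "(\<Sum>a\<in>Poly_Mapping.keys (f + g). F a (Poly_Mapping.lookup (f + g) a))
    = (\<Sum>a\<in>Poly_Mapping.keys f. F a (Poly_Mapping.lookup f a))
      + (\<Sum>a\<in>Poly_Mapping.keys g. F a (Poly_Mapping.lookup g a))"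
proof -
  let ?K = "Poly_Mapping.keys f \<union> Poly_Mapping.keys g"
  have "(\<Sum>a\<in>Poly_Mapping.keys h. F a (Poly_Mapping.lookup h a))
      = (\<Sum>a\<in>?K. F a (Poly_Mapping.lookup h a))" if "Poly_Mapping.keys h \<subseteq> ?K" for h
    using that by (intro sum.mono_neutral_left) (auto simp: assms in_keys_iff)
  from this[of "f + g"] this[of f] this[of g] show ?thesis
    using Poly_Mapping.keys_add[of f g] by (simp add: lookup_add assms sum.distrib)
qed

context complex_algebra
begin

lemma contract_add: "contract (u + v) = contract u + contract v"
  unfolding contract_def by (rule sum_keys_add) (simp_all add: distrib_right)

lemma contract_0 [simp]: "contract 0 = 0"
  by (simp add: contract_def)

lemma contract_frag_of [simp]: "contract (frag_of (x, c)) = scale c x"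
  by (simp add: contract_def)

lemma contract_diff: "contract (u - v) = contract u - contract v"
  using contract_add[of "u - v" v] by simp

lemma contract_zscale: "contract (n \<cdot>\<^sub>\<int> u) = of_int n * contract u"
  by (induction n rule: int_induct[where k = 0])
    (simp_all add: zscale_0 zscale_succ zscale_pred contract_add contract_diff algebra_simps)

lemma contract_frag_extend:
  "contract (frag_extend (\<lambda>(x, c). frag_of (h * x, c)) u) = h * contract u"
  by (induction u rule: frag_induction[OF subset_UNIV])
    (auto simp: frag_extend_diff contract_diff mult_scale_right algebra_simps)

text \<open>The two biadditivity relations contract to \<open>0\<close>, and the balancing relation
  contracts to \<open>c\<close> times the element in \<open>bal\<close>. Hence contraction is well
  defined on tensors, modulo \<open>J\<close>.\<close>

lemma contract_tensor_relations:
  assumes J: "left_ideal J"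
    and bal: "\<And>x f. x * algebra_embed scale ZH f - scale (eval_at \<tau> f) x \<in> J"
    and u: "u \<in> tensor_relations scale ZH \<tau>"
  shows "contract u \<in> J"
  using u unfolding tensor_relations_def
proof (induction rule: zmod.span_induct_alt)
  case base
  then show ?case using J by (simp add: left_ideal_def)
next
  case (step n x y)
  have "contract x \<in> J"
    using step(1)
  proof (elim UnE CollectE exE conjE)
    fix a f c
    assume "x = frag_of (a * algebra_embed scale ZH f, c) - frag_of (a, eval_at \<tau> f * c)"
    then have "contract x = scale c (a * algebra_embed scale ZH f - scale (eval_at \<tau> f) a)"
      by (simp add: contract_diff scale_right_diff_distrib mult.commute)
    then show ?thesis using left_ideal_scale[OF J bal] by simp
  qed (use J in \<open>auto simp: contract_diff scale_right_distrib scale_left_distrib left_ideal_def\<close>)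
  then show ?case
    using J step by (simp add: contract_add contract_zscale left_ideal_def)
qed

text \<open>Balancing moves factors on the right of \<open>x\<close>, so left multiplication sends
  each generating relation to one of the same kind.\<close>

lemma tensor_relations_act:
  assumes "u \<in> tensor_relations scale ZH \<tau>"
  shows "frag_extend (\<lambda>(x, c). frag_of (h * x, c)) u \<in> tensor_relations scale ZH \<tau>"
  using assms unfolding tensor_relations_def
proof (induction rule: zmod.span_induct_alt)
  case base
  then show ?case by (simp add: zmod.span_zero)
next
  case (step n x y)
  let ?a = "frag_extend (\<lambda>(x, c). frag_of (h * x, c)) :: ('h \<times> complex \<Rightarrow>\<^sub>0 int) \<Rightarrow> _"
  have a_zscale: "?a (n \<cdot>\<^sub>\<int> z) = n \<cdot>\<^sub>\<int> ?a z" for n z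
    by (induction n rule: int_induct[where k = 0])
      (simp_all add: zscale_0 zscale_succ zscale_pred frag_extend_add frag_extend_diff)
  let ?R = "{frag_of (x + x', c) - frag_of (x, c) - frag_of (x', c) | x x' c. True}
    \<union> {frag_of (x, c + c') - frag_of (x, c) - frag_of (x, c') | x c c'. True}
    \<union> {frag_of (x * algebra_embed scale ZH f, c) - frag_of (x, eval_at \<tau> f * c) | x f c. True}"
  have "?a x \<in> ?R"
    using step(1)
  proof (elim UnE CollectE exE conjE)
    fix a a' c
    assume "x = frag_of (a + a', c) - frag_of (a, c) - frag_of (a', c)"
    then have "?a x = frag_of (h * a + h * a', c) - frag_of (h * a, c) - frag_of (h * a', c)"
      by (simp add: frag_extend_diff distrib_left)
    then show ?thesis by blast
  next
    fix a c c'
    assume "x = frag_of (a, c + c') - frag_of (a, c) - frag_of (a, c')"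
    then have "?a x = frag_of (h * a, c + c') - frag_of (h * a, c) - frag_of (h * a, c')"
      by (simp add: frag_extend_diff)
    then show ?thesis by blast
  next
    fix a f c
    assume "x = frag_of (a * algebra_embed scale ZH f, c) - frag_of (a, eval_at \<tau> f * c)"
    then have "?a x = frag_of (h * a * algebra_embed scale ZH f, c) - frag_of (h * a, eval_at \<tau> f * c)"
      by (simp add: frag_extend_diff mult.assoc)
    then show ?thesis by blast
  qed
  then show ?case
    using step by (simp add: frag_extend_add a_zscale zmod.span_add zmod.span_scale zmod.span_base)
qed

text \<open>Contraction maps the relations into \<open>J\<close>, hence into \<open>L\<close>, so
  membership in the submodule does not depend on the representative. An element of \<open>L\<close>
  outside \<open>J\<close> shows that it is nonzero, and \<open>1\<close> outside \<open>L\<close>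
  that it is proper.\<close>

theorem reducible_if_intermediate_left_ideal:
  assumes L: "left_ideal L" "J \<subset> L" "L \<noteq> UNIV" and J: "left_ideal J"
    and bal: "\<And>x f. x * algebra_embed scale ZH f - scale (eval_at \<tau> f) x \<in> J"
  shows "reducible_module (principal_series scale ZH \<tau>) (tensor_relations scale ZH \<tau>) (+)
    (principal_series_act scale ZH \<tau>)"
proof -
  let ?T = "tensor_relations scale ZH \<tau>"
  let ?a = "\<lambda>h. frag_extend (\<lambda>(x, c). frag_of (h * x, c)) :: ('h \<times> complex \<Rightarrow>\<^sub>0 int) \<Rightarrow> _"
  define N where "N = (\<lambda>u. u +o ?T) ` {u. contract u \<in> L}"
  have T0: "0 \<in> ?T"
    unfolding tensor_relations_def by (rule zmod.span_zero)
  have Tadd: "x + y \<in> ?T" if "x \<in> ?T" "y \<in> ?T" for x y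
    using that unfolding tensor_relations_def by (rule zmod.span_add)
  have TT: "?T + ?T = ?T"
    using T0 Tadd by (force simp: set_plus_def)
  have TJ: "contract u \<in> J" if "u \<in> ?T" for u
    using contract_tensor_relations[OF J bal that] .
  have coset_eq: "contract u \<in> L" if "u +o ?T = u' +o ?T" "contract u' \<in> L" for u u'
  proof -
    have "u \<in> u' +o ?T" using T0 that(1) by (metis add.right_neutral set_plus_intro2)
    then obtain t where "u = u' + t" "t \<in> ?T" by (auto simp: elt_set_plus_def)
    then show ?thesis using TJ that(2) L by (auto simp: contract_add left_ideal_def)
  qed
  have "submodule_of (principal_series scale ZH \<tau>) ?T (+) (principal_series_act scale ZH \<tau>) N"
    unfolding submodule_of_def
  proof (intro conjI ballI allI)
    show "N \<subseteq> principal_series scale ZH \<tau>"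
      by (auto simp: N_def principal_series_def)
    have "?T = 0 +o ?T" by simp
    then show "?T \<in> N"
      unfolding N_def using L(1) by (intro image_eqI[where x = 0]) (auto simp: left_ideal_def)
  next
    fix A B assume "A \<in> N" "B \<in> N"
    then obtain u u' where u: "A = u +o ?T" "B = u' +o ?T" "contract u \<in> L" "contract u' \<in> L"
      by (auto simp: N_def)
    then have "A + B = (u + u') +o ?T"
      by (metis TT set_plus_rearrange)
    then show "A + B \<in> N"
      using u L(1) by (auto simp: N_def contract_add left_ideal_def)
  next
    fix h A assume "A \<in> N"
    then obtain u where u: "A = u +o ?T" "contract u \<in> L"
      by (auto simp: N_def)
    \<comment> \<open>The action is defined on all elements of a coset at once; the result is again
      a single coset because left multiplication preserves the relations.\<close>
    have "?a h ` A + ?T = ?a h u +o ?T"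
    proof
      show "?a h ` A + ?T \<subseteq> ?a h u +o ?T"
      proof
        fix z assume "z \<in> ?a h ` A + ?T"
        then obtain t t' where "t \<in> ?T" "t' \<in> ?T" "z = ?a h (u + t) + t'"
          by (auto simp: set_plus_def elt_set_plus_def u(1))
        then have "z = ?a h u + (?a h t + t')" "?a h t + t' \<in> ?T"
          using Tadd[OF tensor_relations_act] by (auto simp: frag_extend_add add.assoc)
        then show "z \<in> ?a h u +o ?T" by (auto simp: elt_set_plus_def)
      qed
      have "u \<in> A" using T0 by (auto simp: u(1) elt_set_plus_def)
      then show "?a h u +o ?T \<subseteq> ?a h ` A + ?T"
        by (auto simp: set_plus_def elt_set_plus_def)
    qed
    moreover have "contract (?a h u) \<in> L"
      using u(2) L(1) by (simp add: contract_frag_extend left_ideal_def)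
    ultimately show "principal_series_act scale ZH \<tau> h A \<in> N"
      unfolding principal_series_act_def N_def by auto
  qed
  moreover have "N \<noteq> {?T}"
  proof
    assume N: "N = {?T}"
    obtain x where x: "x \<in> L" "x \<notin> J" using L(2) by blast
    then have "frag_of (x, 1) +o ?T \<in> N" by (auto simp: N_def)
    then have "frag_of (x, 1) +o ?T = ?T" using N by simp
    then have "frag_of (x, 1) \<in> ?T" using T0 by (metis add.right_neutral set_plus_intro2)
    then show False using TJ x(2) by force
  qed
  moreover have "N \<noteq> principal_series scale ZH \<tau>"
  proof
    assume "N = principal_series scale ZH \<tau>"
    then have "frag_of (1, 1) +o ?T \<in> N" by (auto simp: principal_series_def)
    then obtain u where "frag_of (1, 1) +o ?T = u +o ?T" "contract u \<in> L" by (auto simp: N_def)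
    then have "contract (frag_of (1, 1)) \<in> L" using coset_eq by blast
    then have "1 \<in> L" by simp
    then show False using left_ideal_one L by blast
  qed
  ultimately show ?thesis unfolding reducible_module_def by blast
qed

end

section \<open>The group algebra\<close>

lemma zscale_2: "2 \<cdot>\<^sub>\<int> x = x + x"
  using zscale_succ[of 1 x] zscale_succ[of 0 x] by (simp add: zscale_0)

lemma monomial_mult: "monomial a \<nu> * monomial b \<mu> = monomial (a * b) (\<nu> + \<mu>)"
  by transfer (simp add: mult_single)

lemma monomial_add: "monomial (a + b) \<nu> = monomial a \<nu> + monomial b \<nu>"
  by transfer (simp add: single_add)

lemma monomial_diff: "monomial (a - b) \<nu> = monomial a \<nu> - monomial b \<nu>"
  using monomial_add[of "a - b" b \<nu>] by simp

lemma monomial_zero [simp]: "monomial 0 \<nu> = 0"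
  by transfer simp

lemma monomial_one: "monomial 1 0 = 1"
  by transfer simp

lemma monomial_eq_iff: "monomial 1 \<nu> = monomial 1 \<mu> \<longleftrightarrow> \<nu> = \<mu>"
proof
  assume "monomial 1 \<nu> = monomial 1 \<mu>"
  then have "Poly_Mapping.lookup (Poly_Mapping.single \<nu> (1::complex)) \<nu>
      = Poly_Mapping.lookup (Poly_Mapping.single \<mu> 1) \<nu>"
    by (metis monomial.rep_eq)
  then show "\<nu> = \<mu>" by (simp add: lookup_single when_def split: if_splits)
qed simp

lemma group_algebra_induct [case_names zero monomial add]:
  fixes f :: "'y::ab_group_add group_algebra"
  assumes "P 0" "\<And>a \<nu>. P (monomial a \<nu>)" "\<And>f g. P f \<Longrightarrow> P g \<Longrightarrow> P (f + g)"
  shows "P f"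
proof -
  have "P (Group_Algebra g)" for g :: "'y \<Rightarrow>\<^sub>0 complex"
  proof (induction g rule: poly_mapping_single_induct)
    case 1
    then show ?case using assms(1) by (simp add: zero_group_algebra_def)
  next
    case (2 k a)
    then show ?case using assms(2)[of a k] by (simp add: monomial_def)
  next
    case (3 f g)
    then show ?case
      using assms(3)[of "Group_Algebra f" "Group_Algebra g"]
      by (simp add: plus_group_algebra.abs_eq)
  qed
  then show ?thesis by (metis coeffs_inverse)
qed

lemma sum_support_add:
  fixes F :: "'y::ab_group_add \<Rightarrow> complex \<Rightarrow> 'c::comm_monoid_add"
  assumes "\<And>\<nu>. F \<nu> 0 = 0" "\<And>\<nu> a b. F \<nu> (a + b) = F \<nu> a + F \<nu> b"
  shows "(\<Sum>\<nu>\<in>support (f + g). F \<nu> (Defs.coeff (f + g) \<nu>))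
    = (\<Sum>\<nu>\<in>support f. F \<nu> (Defs.coeff f \<nu>)) + (\<Sum>\<nu>\<in>support g. F \<nu> (Defs.coeff g \<nu>))"
  unfolding support_def coeff_def plus_group_algebra.rep_eq
  using assms by (rule sum_keys_add)

lemma sum_support_monomial:
  assumes "\<And>\<nu>. F \<nu> 0 = 0"
  shows "(\<Sum>\<mu>\<in>support (monomial a \<nu>). F \<mu> (Defs.coeff (monomial a \<nu>) \<mu>)) = F \<nu> a"
  using assms by (simp add: support_def coeff_def monomial.rep_eq)

lemma support_0 [simp]: "support 0 = {}"
  by (simp add: support_def zero_group_algebra.rep_eq)

lemma eval_at_0 [simp]: "eval_at \<tau> 0 = 0"
  by (simp add: eval_at_def)

lemma eval_at_add: "eval_at \<tau> (f + g) = eval_at \<tau> f + eval_at \<tau> g"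
  unfolding eval_at_def by (rule sum_support_add) (simp_all add: distrib_right)

lemma eval_at_monomial [simp]: "eval_at \<tau> (monomial a \<nu>) = a * \<tau> \<nu>"
  unfolding eval_at_def by (rule sum_support_monomial) simp

lemma eval_at_diff: "eval_at \<tau> (f - g) = eval_at \<tau> f - eval_at \<tau> g"
  using eval_at_add[of \<tau> "f - g" g] by simp

lemma torus_nonzero: "\<tau> \<in> torus \<Longrightarrow> \<tau> \<nu> \<noteq> 0"
  by (simp add: torus_def)

lemma torus_add: "\<tau> \<in> torus \<Longrightarrow> \<tau> (\<nu> + \<mu>) = \<tau> \<nu> * \<tau> \<mu>"
  by (simp add: torus_def)

lemma torus_0: "\<tau> \<in> torus \<Longrightarrow> \<tau> 0 = 1"
  using torus_add[of \<tau> 0 0] torus_nonzero[of \<tau> 0] by simp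

lemma torus_minus: "\<tau> \<in> torus \<Longrightarrow> \<tau> (- \<nu>) = inverse (\<tau> \<nu>)"
  using torus_add[of \<tau> "- \<nu>" \<nu>] by (simp add: torus_0 torus_nonzero field_simps)

lemma torus_diff: "\<tau> \<in> torus \<Longrightarrow> \<tau> (\<nu> - \<mu>) = \<tau> \<nu> / \<tau> \<mu>"
  using torus_add[of \<tau> \<nu> "- \<mu>"] by (simp add: torus_minus field_simps)

lemma torus_zscale_eq_1:
  assumes "\<tau> \<in> torus" "\<tau> \<nu> = 1" shows "\<tau> (n \<cdot>\<^sub>\<int> \<nu>) = 1"
  by (induction n rule: int_induct[where k = 0])
    (simp_all add: zscale_0 zscale_succ zscale_pred torus_0 torus_add torus_diff assms)

lemma eval_at_1: "\<tau> \<in> torus \<Longrightarrow> eval_at \<tau> 1 = 1"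
  using eval_at_monomial[of \<tau> 1 0] by (simp add: monomial_one torus_0)

lemma eval_at_mult:
  assumes "\<tau> \<in> torus"
  shows "eval_at \<tau> (f * g) = eval_at \<tau> f * eval_at \<tau> g"
proof (induction f rule: group_algebra_induct)
  case (monomial a \<nu>)
  show ?case
    by (induction g rule: group_algebra_induct)
      (simp_all add: monomial_mult torus_add[OF assms] eval_at_add distrib_left)
qed (simp_all add: eval_at_add distrib_right)

lemma algebra_act_add: "algebra_act w (f + g) = algebra_act w f + algebra_act w g"
  unfolding algebra_act_def by (rule sum_support_add) (simp_all add: monomial_add)

lemma algebra_act_monomial [simp]: "algebra_act w (monomial a \<nu>) = monomial a (w \<nu>)"
  unfolding algebra_act_def by (rule sum_support_monomial) simp

lemma algebra_act_0 [simp]: "algebra_act w 0 = 0"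
  by (simp add: algebra_act_def)

lemma algebra_act_diff: "algebra_act w (f - g) = algebra_act w f - algebra_act w g"
  using algebra_act_add[of w "f - g" g] by simp

lemma algebra_act_mult:
  assumes "additive w"
  shows "algebra_act w (f * g) = algebra_act w f * algebra_act w g"
proof (induction f rule: group_algebra_induct)
  case (monomial a \<nu>)
  show ?case
    by (induction g rule: group_algebra_induct)
      (simp_all add: monomial_mult additive.add[OF assms] algebra_act_add distrib_left)
qed (simp_all add: algebra_act_add distrib_right)

lemma algebra_act_1: "additive w \<Longrightarrow> algebra_act w 1 = 1"
  using algebra_act_monomial[of w 1 0] by (simp add: monomial_one additive.zero)

text \<open>Reduces injectivity of the action to that of \<open>push\<close>, already established
  for the absence of zero divisors.\<close>

lemma coeffs_algebra_act: "Defs.coeffs (algebra_act w f) = push w (Defs.coeffs f)"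
  by (induction f rule: group_algebra_induct)
    (simp_all add: algebra_act_add plus_group_algebra.rep_eq zero_group_algebra.rep_eq
      monomial.rep_eq push_add push_single push_def[of _ 0])

lemma algebra_act_eq_0_iff:
  assumes "inj w"
  shows "algebra_act w f = 0 \<longleftrightarrow> f = 0"
proof
  assume "algebra_act w f = 0"
  then have "push w (Defs.coeffs f) = 0"
    using coeffs_algebra_act[of w f] by (simp add: zero_group_algebra.rep_eq)
  then have "Defs.coeffs f = 0" using push_eq_0[OF assms] by blast
  then show "f = 0" by (metis coeffs_inject zero_group_algebra.rep_eq)
qed simp

text \<open>The definite description is justified by cross-multiplication: the action is
  multiplicative, and injectivity of \<open>w\<close> keeps denominators nonzero.\<close>

lemma fract_act_Fract:
  assumes w: "additive w" "inj w" and d: "d \<noteq> 0"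
  shows "fract_act w (Fract n d) = Fract (algebra_act w n) (algebra_act w d)"
  unfolding fract_act_def
proof (rule the_equality)
  show "\<forall>n' d'. d' \<noteq> 0 \<longrightarrow> Fract n d = Fract n' d' \<longrightarrow>
      Fract (algebra_act w n) (algebra_act w d) = Fract (algebra_act w n') (algebra_act w d')"
  proof (intro allI impI)
    fix n' d' assume d': "d' \<noteq> 0" and "Fract n d = Fract n' d'"
    then have "n * d' = n' * d" using d by (simp add: eq_fract)
    then have "algebra_act w n * algebra_act w d' = algebra_act w n' * algebra_act w d"
      by (simp flip: algebra_act_mult[OF w(1)])
    then show "Fract (algebra_act w n) (algebra_act w d) = Fract (algebra_act w n') (algebra_act w d')"
      using d d' by (simp add: eq_fract algebra_act_eq_0_iff[OF w(2)])
  qed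
qed (use d in blast)

text \<open>
  For a comaximal pair, the reduced form of the fraction is unique up to units without any appeal to
  unique factorization.
\<close>
lemma zeta_den_vanishes_comaximal:
  fixes N D :: "'y::free_ab_group_fin_rank group_algebra"
  assumes \<tau>: "\<tau> \<in> torus" and bez: "u * N + v * D = 1" and D: "D \<noteq> 0"
  shows "zeta_den_vanishes \<tau> (Fract N D) \<longleftrightarrow> eval_at \<tau> D = 0"
proof
  assume "zeta_den_vanishes \<tau> (Fract N D)"
  then obtain n d where nd: "d \<noteq> 0" "coprime n d" "Fract N D = Fract n d" "eval_at \<tau> d = 0"
    unfolding zeta_den_vanishes_def by blast
  then have eq: "N * d = n * D" using D by (simp add: eq_fract)
  \<comment> \<open>The factor by which \<open>(n, d)\<close> differs from \<open>(N, D)\<close>. It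
    divides both \<open>n\<close> and \<open>d\<close>, so coprimality makes it a unit, and
    \<open>\<tau>\<close> does not vanish at units.\<close>
  define q where "q = u * n + v * d"
  have "d = (u * N + v * D) * d" using bez by simp
  also have "\<dots> = q * D" using eq by (simp add: q_def algebra_simps)
  finally have d: "d = q * D" .
  have "n = (u * N + v * D) * n" using bez by simp
  also have "\<dots> = q * N" using eq by (simp add: q_def algebra_simps)
  finally have "n = q * N" .
  then have "q dvd 1" using nd(2) d by (metis coprime_common_divisor dvd_triv_left)
  then obtain r where "1 = q * r" by blast
  then have "eval_at \<tau> q \<noteq> 0"
    by (metis \<tau> eval_at_1 eval_at_mult mult_zero_left zero_neq_one)
  then show "eval_at \<tau> D = 0" using nd(4) d by (simp add: eval_at_mult[OF \<tau>])
next
  assume "eval_at \<tau> D = 0"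
  moreover have "coprime N D"
  proof (rule coprimeI)
    fix c assume "c dvd N" "c dvd D"
    then have "c dvd u * N + v * D" by simp
    then show "c dvd 1" using bez by simp
  qed
  ultimately show "zeta_den_vanishes \<tau> (Fract N D)"
    using D unfolding zeta_den_vanishes_def by blast
qed

section \<open>The fractions attached to coroots\<close>

context root_generating_system
begin

lemma pairing_add: "pairing S x (y + z) = pairing S x y + pairing S x z"
  using pairing_additive_right by (simp add: additive.add)

lemma pairing_0 [simp]: "pairing S x 0 = 0"
  using pairing_additive_right by (rule additive.zero)

lemma pairing_diff: "pairing S x (y - z) = pairing S x y - pairing S x z"
  using pairing_additive_right by (rule additive.diff)

lemma pairing_zscale: "pairing S x (n \<cdot>\<^sub>\<int> y) = n * pairing S x y"
  by (induction n rule: int_induct[where k = 0])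
    (simp_all add: zscale_0 zscale_succ zscale_pred pairing_add pairing_diff algebra_simps)

lemma pairing_root_coroot: "i \<in> index_set S \<Longrightarrow> pairing S (root S i) (coroot S i) = 2"
  by (simp add: pairing_cartan cartan_diag)

lemma coroot_not_torsion:
  assumes "i \<in> index_set S"
  shows "coroot S i \<noteq> 0" "coroot S i + coroot S i \<noteq> 0"
  using pairing_root_coroot[OF assms]
    pairing_add[of "root S i" "coroot S i" "coroot S i"] by auto

end

context hecke_parameters
begin

text \<open>
  With \<open>X = Z\<^sup>-\<^sup>\<mu>\<close>, the fraction attached to the coroot \<open>\<mu> = w.\<alpha>\<^sub>i\<^sup>\<or>\<close> is
  \<open>(1 - \<sigma>\<^sub>i\<sigma>'\<^sub>i X)(1 + \<sigma>\<^sub>i\<sigma>'\<^sub>i\<^sup>-\<^sup>1 X) / (1 - X)(1 + X)\<close>. Under the standing assumption, the only possible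
  cancellation is that of \<open>1 + X\<close>, when \<open>\<sigma>\<^sub>i = \<sigma>'\<^sub>i\<close>.
\<close>
definition singular :: "'i \<Rightarrow> complex \<Rightarrow> bool"
  where "singular i z \<longleftrightarrow> (if \<sigma> i = \<sigma>' i then z = 1 else z\<^sup>2 = 1)"

definition zeta_num :: "'i \<Rightarrow> 'y \<Rightarrow> 'y group_algebra"
  where "zeta_num i \<mu> = (if \<sigma> i = \<sigma>' i then 1 - monomial ((\<sigma> i)\<^sup>2) (- \<mu>)
    else (1 - monomial (\<sigma> i * \<sigma>' i) (- \<mu>)) * (1 + monomial (\<sigma> i / \<sigma>' i) (- \<mu>)))"

definition zeta_den :: "'i \<Rightarrow> 'y \<Rightarrow> 'y group_algebra"
  where "zeta_den i \<mu> =
    (if \<sigma> i = \<sigma>' i then 1 - monomial 1 (- \<mu>) else 1 - monomial 1 (- (\<mu> + \<mu>)))"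

lemma zeta_den_coroot_nonzero:
  assumes "i \<in> index_set S"
  shows "zeta_den i (coroot S i) \<noteq> 0" "1 - monomial 1 (- (coroot S i + coroot S i)) \<noteq> 0"
proof -
  have nz: "monomial 1 (- x) \<noteq> 1" if "x \<noteq> 0" for x :: 'y
    using that monomial_eq_iff[of "- x" 0] by (simp add: monomial_one)
  note nz = nz[OF coroot_not_torsion(1)[OF assms]] nz[OF coroot_not_torsion(2)[OF assms]]
  show "1 - monomial 1 (- (coroot S i + coroot S i)) \<noteq> 0"
    using nz(2) by (metis right_minus_eq)
  then show "zeta_den i (coroot S i) \<noteq> 0"
    using nz(1) unfolding zeta_den_def by (metis right_minus_eq)
qed

text \<open>Over the denominator \<open>1 - X^2\<close>, the numerator collapses through
  \<open>\<sigma> \<sigma>^-1 = 1\<close> and \<open>\<sigma>' \<sigma>'^-1 = 1\<close>. For equal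
  parameters it is \<open>(1 - \<sigma>^2 X) (1 + X)\<close>, and \<open>1 + X\<close>
  cancels.\<close>

lemma zeta_simple_eq:
  assumes i: "i \<in> index_set S"
  shows "zeta_simple S \<sigma> \<sigma>' i = Fract (zeta_num i (coroot S i)) (zeta_den i (coroot S i))"
proof -
  define X where "X = monomial 1 (- coroot S i)"
  define D where "D = 1 - monomial 1 (- (2 \<cdot>\<^sub>\<int> coroot S i))"
  define C where "C a = monomial a (0::'y)" for a
  have mono: "monomial a (- coroot S i) = C a * X" for a
    by (simp add: C_def X_def monomial_mult)
  have D: "D = 1 - X * X"
    by (simp add: D_def X_def monomial_mult zscale_2)
  have D0: "D \<noteq> 0"
    using zeta_den_coroot_nonzero[OF i] by (simp add: D_def zscale_2)
  have C: "C (a * b) = C a * C b" "C (a - b) = C a - C b" "C 1 = 1" for a b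
    by (simp_all add: C_def monomial_mult monomial_diff monomial_one)
  define s t si ti where "s = C (\<sigma> i)" "t = C (\<sigma>' i)" "si = C (inverse (\<sigma> i))" "ti = C (inverse (\<sigma>' i))"
  have inv: "s * si = 1" "t * ti = 1"
    using sigma_nonzero[OF i] by (simp_all add: s_t_si_ti_def flip: C)
  let ?N = "- s * (s - si + (t - ti) * X) + s * s * D"
  have "zeta_simple S \<sigma> \<sigma>' i = Fract ?N D"
    using D0 unfolding zeta_simple_def Q_fraction_def D_def[symmetric] mono
    by (simp add: C_def[symmetric] C power2_eq_square s_t_si_ti_def minus_fract mult_fract add_fract)
  also have "\<dots> = Fract (zeta_num i (coroot S i)) (zeta_den i (coroot S i))"
  proof (cases "\<sigma> i = \<sigma>' i")
    case True
    then have "t = s" "ti = si" by (simp_all add: s_t_si_ti_def)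
    moreover have "zeta_num i (coroot S i) = 1 - s * s * X" "zeta_den i (coroot S i) = 1 - X"
      using True by (simp_all add: zeta_num_def zeta_den_def mono C power2_eq_square s_t_si_ti_def)
    moreover have "(- s * (s - si + (s - si) * X) + s * s * D) * (1 - X) = (1 - s * s * X) * D"
    proof -
      have e: "s * (s - si + (s - si) * X) = (s * s - s * si) * (1 + X)"
        by (simp add: algebra_simps)
      show ?thesis unfolding D mult_minus_left e inv by (simp add: algebra_simps)
    qed
    ultimately show ?thesis
      using D0 zeta_den_coroot_nonzero(1)[OF i] by (simp add: eq_fract)
  next
    case False
    then have "zeta_num i (coroot S i) = (1 - s * t * X) * (1 + s * ti * X)" "zeta_den i (coroot S i) = D"
      by (simp_all add: zeta_num_def zeta_den_def mono C s_t_si_ti_def D_def zscale_2 divide_inverse)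
    moreover have "- s * (s - si + (t - ti) * X) + s * s * D = (1 - s * t * X) * (1 + s * ti * X)"
    proof -
      have "s * (s - si + (t - ti) * X) = s * s - s * si + s * (t - ti) * X"
        "(1 - s * t * X) * (1 + s * ti * X)
          = 1 - s * t * X + s * ti * X - s * s * (t * ti) * (X * X)"
        by (simp_all add: algebra_simps)
      then show ?thesis unfolding D mult_minus_left inv by (simp only:) (simp add: algebra_simps)
    qed
    ultimately show ?thesis by simp
  qed
  finally show ?thesis .
qed

text \<open>As polynomials in \<open>X\<close>, numerator and denominator have no common root: this
  amounts to \<open>\<sigma> \<sigma>'\<close> and \<open>\<sigma> / \<sigma>'\<close> avoiding
  \<open>1\<close> and \<open>-1\<close>, or to \<open>\<sigma>^2\<close> avoiding \<open>1\<close>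
  if the parameters agree. It is proved for arbitrary \<open>\<mu>\<close> so that it survives
  transport by Weyl group elements.\<close>

lemma zeta_comaximal:
  assumes i: "i \<in> index_set S"
  shows "\<exists>u v. u * zeta_num i \<mu> + v * zeta_den i \<mu> = 1"
proof -
  define X where "X = monomial 1 (- \<mu>)"
  define C where "C a = monomial a (0::'y)" for a
  have C: "C (a * b) = C a * C b" "C (a - b) = C a - C b" "C 1 = 1" for a b
    by (simp_all add: C_def monomial_mult monomial_diff monomial_one)
  have mono: "monomial a (- \<mu>) = C a * X" for a
    by (simp add: C_def X_def monomial_mult)
  have scale: "\<exists>u v. u * N + v * D = 1" if "u * N + v * D = C \<kappa>" "\<kappa> \<noteq> 0" for N D u v \<kappa>
  proof -
    have "C (inverse \<kappa>) * u * N + C (inverse \<kappa>) * v * D = C (inverse \<kappa>) * (u * N + v * D)"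
      by (simp add: algebra_simps)
    also have "\<dots> = 1" using that by (simp flip: C)
    finally show ?thesis by blast
  qed
  show ?thesis
  proof (cases "\<sigma> i = \<sigma>' i")
    case True
    have "(\<sigma> i)\<^sup>2 \<noteq> 1"
      using sigma_generic[OF i] True sigma_nonzero[OF i] by (auto simp: power2_eq_square field_simps)
    have eq: "1 * zeta_num i \<mu> + (- C ((\<sigma> i)\<^sup>2)) * zeta_den i \<mu> = C (1 - (\<sigma> i)\<^sup>2)"
      using True by (simp add: zeta_num_def zeta_den_def mono C algebra_simps flip: X_def)
    show ?thesis by (rule scale[OF eq]) (use \<open>(\<sigma> i)\<^sup>2 \<noteq> 1\<close> in simp)
  next
    case False
    define p q where "p = \<sigma> i * \<sigma>' i" and "q = \<sigma> i / \<sigma>' i"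
    have "p \<noteq> 1" "p \<noteq> - 1" "q \<noteq> 1" "q \<noteq> - 1"
      using sigma_generic[OF i] False sigma_nonzero[OF i] by (auto simp: p_def q_def field_simps)
    then have "(1 - p * p) * (1 - q * q) \<noteq> 0"
      by (simp add: square_eq_1_iff)
    \<comment> \<open>The conjugate factors turn the numerator into
      \<open>(1 - p^2 X^2) (1 - q^2 X^2)\<close>, which is \<open>(1 - p^2) (1 - q^2)\<close> modulo
      \<open>1 - X^2\<close>; the other cofactor is the negative of the quotient of that
      division.\<close>
    moreover have "(1 + C p * X) * (1 - C q * X) * zeta_num i \<mu>
        + (- (C p * C p * (1 - C q * C q) + C q * C q * (1 - C p * C p)
            + C p * C p * C q * C q * (1 - X * X))) * zeta_den i \<mu>
      = C ((1 - p * p) * (1 - q * q))"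
    proof -
      have n: "zeta_num i \<mu> = (1 - C p * X) * (1 + C q * X)" and d: "zeta_den i \<mu> = 1 - X * X"
        using False by (simp_all add: zeta_num_def zeta_den_def mono p_def q_def)
          (simp add: X_def monomial_mult)
      show ?thesis unfolding n d C by (simp add: algebra_simps)
    qed
    ultimately show ?thesis by (intro scale)
  qed
qed

lemma zeta_den_vanishes_iff:
  assumes i: "i \<in> index_set S" and w: "additive w" "inj w" and \<tau>: "\<tau> \<in> torus"
  shows "zeta_den_vanishes \<tau> (fract_act w (zeta_simple S \<sigma> \<sigma>' i)) \<longleftrightarrow> singular i (\<tau> (w (coroot S i)))"
proof -
  let ?\<mu> = "w (coroot S i)"
  have act: "algebra_act w (zeta_num i (coroot S i)) = zeta_num i ?\<mu>"
    "algebra_act w (zeta_den i (coroot S i)) = zeta_den i ?\<mu>"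
    by (simp_all add: zeta_num_def zeta_den_def algebra_act_mult[OF w(1)] algebra_act_diff
        algebra_act_add algebra_act_1[OF w(1)] additive.minus[OF w(1)] additive.add[OF w(1)]
        additive.diff[OF w(1)])
  then have nz: "zeta_den i ?\<mu> \<noteq> 0"
    using zeta_den_coroot_nonzero(1)[OF i] algebra_act_eq_0_iff[OF w(2)] by metis
  have "fract_act w (zeta_simple S \<sigma> \<sigma>' i) = Fract (zeta_num i ?\<mu>) (zeta_den i ?\<mu>)"
    by (simp add: zeta_simple_eq[OF i] fract_act_Fract[OF w zeta_den_coroot_nonzero(1)[OF i]] act)
  moreover obtain u v where "u * zeta_num i ?\<mu> + v * zeta_den i ?\<mu> = 1"
    using zeta_comaximal[OF i] by blast
  ultimately have "zeta_den_vanishes \<tau> (fract_act w (zeta_simple S \<sigma> \<sigma>' i))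
      \<longleftrightarrow> eval_at \<tau> (zeta_den i ?\<mu>) = 0"
    using zeta_den_vanishes_comaximal[OF \<tau>] nz by metis
  also have "\<dots> \<longleftrightarrow> singular i (\<tau> ?\<mu>)"
    by (auto simp: zeta_den_def singular_def eval_at_diff eval_at_1[OF \<tau>] torus_minus[OF \<tau>]
        torus_add[OF \<tau>] torus_diff[OF \<tau>] torus_nonzero[OF \<tau>] power2_eq_square field_simps)
  finally show ?thesis .
qed

end

section \<open>The Weyl group\<close>

lemma additive_zscale:
  assumes "additive f" shows "f (n \<cdot>\<^sub>\<int> x) = n \<cdot>\<^sub>\<int> f x"
  by (induction n rule: int_induct[where k = 0])
    (simp_all add: zscale_0 zscale_succ zscale_pred additive.zero[OF assms] additive.add[OF assms]
      additive.diff[OF assms])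

context root_generating_system
begin

definition word :: "'i list \<Rightarrow> 'y \<Rightarrow> 'y"
  where "word js = foldr (\<lambda>i v. refl S i \<circ> v) js id"

lemma word_Nil [simp]: "word [] = id"
  by (simp add: word_def)

lemma word_Cons [simp]: "word (j # js) = refl S j \<circ> word js"
  by (simp add: word_def)

lemma word_append: "word (js @ ks) = word js \<circ> word ks"
  by (induction js) (simp_all add: comp_assoc)

lemma refl_involution: "i \<in> index_set S \<Longrightarrow> refl S i (refl S i v) = v"
  by (simp add: refl_def pairing_diff pairing_zscale pairing_root_coroot
      zmod.scale_left_diff_distrib algebra_simps flip: zmod.scale_left_distrib)

lemma additive_refl: "additive (refl S i)"
  by standard (simp add: refl_def pairing_add zmod.scale_left_distrib)

lemma additive_word: "additive (word js)"
  by (induction js) (simp_all add: additive_def additive.add[OF additive_refl])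

lemma word_rev: "set js \<subseteq> index_set S \<Longrightarrow> word (rev js) (word js v) = v"
  by (induction js arbitrary: v) (simp_all add: word_append refl_involution)

lemma word_rev': "set js \<subseteq> index_set S \<Longrightarrow> word js (word (rev js) v) = v"
  using word_rev[of "rev js"] by simp

lemma bij_word: "set js \<subseteq> index_set S \<Longrightarrow> bij (word js)"
  by (rule bij_betw_byWitness[where f' = "word (rev js)"]) (simp_all add: word_rev word_rev')

lemma inv_word: "set js \<subseteq> index_set S \<Longrightarrow> inv (word js) = word (rev js)"
  by (rule inv_equality) (simp_all add: word_rev word_rev')

lemma weyl_iff: "w \<in> weyl S \<longleftrightarrow> (\<exists>js. set js \<subseteq> index_set S \<and> w = word js)"
proof
  assume "w \<in> weyl S"
  then show "\<exists>js. set js \<subseteq> index_set S \<and> w = word js"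
    unfolding weyl_def
  proof induction
    case gen_id
    then show ?case by (intro exI[of _ "[]"]) simp
  next
    case (gen_base g)
    then obtain i where "i \<in> index_set S" "g = refl S i" by blast
    then show ?case by (intro exI[of _ "[i]"]) simp
  next
    case (gen_comp f g)
    then obtain js ks where "set js \<subseteq> index_set S" "f = word js" "set ks \<subseteq> index_set S" "g = word ks"
      by blast
    then show ?case by (intro exI[of _ "js @ ks"]) (simp add: word_append)
  next
    case (gen_inv f)
    then obtain js where "set js \<subseteq> index_set S" "f = word js" by blast
    then show ?case by (intro exI[of _ "rev js"]) (simp add: inv_word)
  qed
next
  assume "\<exists>js. set js \<subseteq> index_set S \<and> w = word js"
  then obtain js where js: "set js \<subseteq> index_set S" "w = word js" by blast
  have "word js \<in> weyl S"
    using js(1) unfolding weyl_def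
    by (induction js) (auto intro: generated_group.intros simp: gen_id)
  then show "w \<in> weyl S" using js(2) by simp
qed

lemma word_in_weyl: "set js \<subseteq> index_set S \<Longrightarrow> word js \<in> weyl S"
  using weyl_iff by blast

lemma id_in_weyl: "id \<in> weyl S"
  by (simp add: weyl_def gen_id)

lemma refl_comp_in_weyl: "i \<in> index_set S \<Longrightarrow> w \<in> weyl S \<Longrightarrow> refl S i \<circ> w \<in> weyl S"
  unfolding weyl_def by (intro gen_comp[OF gen_base]) auto

lemma refl_in_weyl: "i \<in> index_set S \<Longrightarrow> refl S i \<in> weyl S"
  using refl_comp_in_weyl[OF _ id_in_weyl] by simp

lemma weyl_additive: "w \<in> weyl S \<Longrightarrow> additive w"
  using weyl_iff[of w] additive_word by auto

lemma weyl_bij: "w \<in> weyl S \<Longrightarrow> bij w"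
  using weyl_iff[of w] bij_word by auto

lemma ex_reduced_word:
  assumes "w \<in> weyl S"
  shows "\<exists>js. set js \<subseteq> index_set S \<and> length js = weyl_length S w \<and> w = word js"
proof -
  have "\<exists>n js. set js \<subseteq> index_set S \<and> length js = n \<and> w = foldr (\<lambda>i v. refl S i \<circ> v) js id"
    using assms unfolding weyl_iff word_def by blast
  then show ?thesis
    unfolding weyl_length_def word_def by (rule LeastI_ex)
qed

lemma weyl_length_word_le: "set js \<subseteq> index_set S \<Longrightarrow> weyl_length S (word js) \<le> length js"
  unfolding weyl_length_def word_def by (rule Least_le) blast

lemma weyl_length_id: "weyl_length S id = 0"
  using weyl_length_word_le[of "[]"] by simp

section \<open>Sign of a word and parity of the length\<close>

lemma coroots_coefficients_unique:
  assumes b: "bij_betw b {..<n} (index_set S)"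
    and eq: "(\<Sum>k<n. c k \<cdot>\<^sub>\<int> coroot S (b k)) = (\<Sum>k<n. d k \<cdot>\<^sub>\<int> coroot S (b k))"
    and k: "k < n"
  shows "c k = d k"
proof -
  let ?g = "\<lambda>k. coroot S (b k)"
  have inj: "inj_on ?g {..<n}"
    using comp_inj_on[of b "{..<n}" "coroot S"] b coroots_free(1)
    by (simp add: bij_betw_def comp_def)
  have img: "?g ` {..<n} = coroot S ` index_set S"
    using b unfolding bij_betw_def by (metis image_image)
  let ?u = "\<lambda>v. (\<lambda>k. c k - d k) (the_inv_into {..<n} ?g v)"
  have "(\<Sum>v\<in>?g ` {..<n}. ?u v \<cdot>\<^sub>\<int> v) = (\<Sum>k<n. (c k - d k) \<cdot>\<^sub>\<int> ?g k)"
    by (subst sum.reindex[OF inj]) (simp add: the_inv_into_f_f[OF inj])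
  also have "\<dots> = 0"
    using eq by (simp add: zmod.scale_left_diff_distrib sum_subtractf)
  finally have "?u (?g k) = 0"
    using k coroots_free(2) img
    by (intro zmod.independentD[of "coroot S ` index_set S" "?g ` {..<n}" ?u]) (auto simp: finite_index)
  then show ?thesis using k by (simp add: the_inv_into_f_f[OF inj])
qed

text \<open>The sign of a word is the determinant of its action on the span of the simple coroots.\<close>
lemma length_parity:
  assumes js: "set js \<subseteq> index_set S" and ks: "set ks \<subseteq> index_set S" and eq: "word js = word ks"
  shows "even (length js) \<longleftrightarrow> even (length ks)"
proof -
  obtain b and n :: nat where b: "bij_betw b {..<n} (index_set S)"
    using ex_bij_betw_nat_finite[OF finite_index] by (auto simp: lessThan_atLeast0)
  have bI: "b k \<in> index_set S" if "k < n" for k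
    using b that by (auto simp: bij_betw_def)
  define R :: "'i \<Rightarrow> int mat" where
    "R i = mat n n (\<lambda>(k, l). (if k = l then 1 else 0) - (if b k = i then cartan S (b l) i else 0))" for i
  have Rc: "R i \<in> carrier_mat n n" for i
    by (simp add: R_def)
  have det_R: "det (R i) = - 1" if i: "i \<in> index_set S" for i
  proof -
    obtain k0 where k0: "k0 < n" "b k0 = i"
      using b i unfolding bij_betw_def by (metis imageE lessThan_iff)
    have bk: "b k = i \<longleftrightarrow> k = k0" if "k < n" for k
      using b k0 that by (auto simp: bij_betw_def inj_on_def)
    \<comment> \<open>Apart from row \<open>k0\<close>, the matrix is the identity. A permutation
      that moves no index other than \<open>k0\<close> is itself the identity, so only the diagonal
      contributes.\<close>
    have "(\<Prod>k = 0..<n. R i $$ (k, p k)) = 0" if p: "p permutes {0..<n}" "p \<noteq> id" for p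
    proof -
      have "\<exists>k<n. k \<noteq> k0 \<and> p k \<noteq> k"
      proof (rule ccontr)
        assume "\<not> ?thesis"
        then have pk: "p k = k" if "k \<noteq> k0" for k
          using p(1) that by (cases "k < n") (auto simp: permutes_def)
        then have "p k0 = k0"
          using permutes_inj[OF p(1)] by (metis injD)
        with pk have "p = id" by (metis eq_id_iff)
        then show False using p(2) by simp
      qed
      then obtain k where k: "k < n" "k \<noteq> k0" "p k \<noteq> k" by blast
      then have "p k < n" using permutes_in_image[OF p(1), of k] by simp
      with k have "R i $$ (k, p k) = 0" by (simp add: R_def bk)
      then show ?thesis using k(1) by (intro prod_zero) auto
    qed
    then have "det (R i) = (\<Sum>p\<in>{p. p permutes {0..<n}}. if p = id then \<Prod>k = 0..<n. R i $$ (k, k) else 0)"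
      unfolding det_def'[OF Rc] by (intro sum.cong) auto
    also have "\<dots> = (\<Prod>k = 0..<n. R i $$ (k, k))"
      by (simp add: finite_permutations permutes_id)
    also have "\<dots> = R i $$ (k0, k0) * (\<Prod>k\<in>{0..<n} - {k0}. R i $$ (k, k))"
      using k0 by (intro prod.remove) auto
    also have "(\<Prod>k\<in>{0..<n} - {k0}. R i $$ (k, k)) = 1"
      by (intro prod.neutral) (simp add: R_def bk)
    also have "R i $$ (k0, k0) = - 1"
      using k0 i by (simp add: R_def cartan_diag)
    finally show ?thesis by simp
  qed
  define M where "M js = foldr (\<lambda>i A. R i * A) js (1\<^sub>m n)" for js
  have Mc: "M js \<in> carrier_mat n n" for js
    by (induction js) (simp_all add: M_def mult_carrier_mat[OF Rc])
  have det_M: "det (M js) = (- 1) ^ length js" if "set js \<subseteq> index_set S" for js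
    using that
  proof (induction js)
    case (Cons j js)
    have "det (M (j # js)) = det (R j) * det (M js)"
      using det_mult[OF Rc Mc] by (simp add: M_def)
    then show ?case using Cons det_R by simp
  qed (simp add: M_def)
  have act_R: "refl S i (coroot S (b l)) = (\<Sum>k<n. R i $$ (k, l) \<cdot>\<^sub>\<int> coroot S (b k))"
    if i: "i \<in> index_set S" and l: "l < n" for i l
  proof -
    obtain k0 where k0: "k0 < n" "b k0 = i"
      using b i unfolding bij_betw_def by (metis imageE lessThan_iff)
    have bk: "b k = i \<longleftrightarrow> k = k0" if "k < n" for k
      using b k0 that by (auto simp: bij_betw_def inj_on_def)
    have "(\<Sum>k<n. R i $$ (k, l) \<cdot>\<^sub>\<int> coroot S (b k))
        = (\<Sum>k<n. (if k = l then coroot S (b k) else 0)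
            - (if k = k0 then cartan S (b l) i \<cdot>\<^sub>\<int> coroot S (b k) else 0))"
      using l by (intro sum.cong) (auto simp: R_def bk zmod.scale_left_diff_distrib)
    also have "\<dots> = refl S i (coroot S (b l))"
      using l k0 i bI by (simp add: sum_subtractf refl_def pairing_cartan)
    finally show ?thesis by simp
  qed
  have act_M: "word js (coroot S (b l)) = (\<Sum>k<n. M js $$ (k, l) \<cdot>\<^sub>\<int> coroot S (b k))"
    if "set js \<subseteq> index_set S" and l: "l < n" for js l
    using that(1)
  proof (induction js)
    case Nil
    have "(\<Sum>k<n. M [] $$ (k, l) \<cdot>\<^sub>\<int> coroot S (b k)) = (\<Sum>k<n. if k = l then coroot S (b k) else 0)"
      using l by (intro sum.cong) (auto simp: M_def)
    then show ?case using l by simp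
  next
    case (Cons j js)
    have "word (j # js) (coroot S (b l)) = (\<Sum>k<n. M js $$ (k, l) \<cdot>\<^sub>\<int> refl S j (coroot S (b k)))"
      using Cons by (simp add: additive.sum[OF additive_refl] additive_zscale[OF additive_refl])
    also have "\<dots> = (\<Sum>k<n. \<Sum>m<n. (R j $$ (m, k) * M js $$ (k, l)) \<cdot>\<^sub>\<int> coroot S (b m))"
      using Cons by (intro sum.cong) (simp_all add: act_R zmod.scale_sum_right mult.commute)
    also have "\<dots> = (\<Sum>m<n. (\<Sum>k<n. R j $$ (m, k) * M js $$ (k, l)) \<cdot>\<^sub>\<int> coroot S (b m))"
      by (subst sum.swap) (simp add: zmod.scale_sum_left)
    also have "\<dots> = (\<Sum>m<n. M (j # js) $$ (m, l) \<cdot>\<^sub>\<int> coroot S (b m))"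
    proof (intro sum.cong refl)
      fix m assume "m \<in> {..<n}"
      then have "M (j # js) $$ (m, l) = (\<Sum>k<n. R j $$ (m, k) * M js $$ (k, l))"
        using l Mc[of js] Rc[of j]
        by (simp add: M_def scalar_prod_def lessThan_atLeast0)
      then show "(\<Sum>k<n. R j $$ (m, k) * M js $$ (k, l)) \<cdot>\<^sub>\<int> coroot S (b m)
          = M (j # js) $$ (m, l) \<cdot>\<^sub>\<int> coroot S (b m)"
        by simp
    qed
    finally show ?case .
  qed
  have "M js = M ks"
  proof (rule eq_matI)
    fix k l assume "k < dim_row (M ks)" "l < dim_col (M ks)"
    then have kl: "k < n" "l < n" using Mc[of ks] by auto
    have "(\<Sum>k<n. M js $$ (k, l) \<cdot>\<^sub>\<int> coroot S (b k)) = (\<Sum>k<n. M ks $$ (k, l) \<cdot>\<^sub>\<int> coroot S (b k))"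
      using act_M[OF js kl(2)] act_M[OF ks kl(2)] eq by simp
    from coroots_coefficients_unique[OF b this kl(1)] show "M js $$ (k, l) = M ks $$ (k, l)" .
  qed (use Mc[of js] Mc[of ks] in auto)
  then have "(- 1 :: int) ^ length js = (- 1) ^ length ks"
    using det_M[OF js] det_M[OF ks] by simp
  then show ?thesis by (cases "even (length js)"; cases "even (length ks)") auto
qed

text \<open>The multiplication rules for \<open>H_s H_w\<close> speak only of length changes by
  exactly one. Prefixing a letter, in both directions, bounds the change by one; parity excludes
  zero.\<close>

lemma weyl_length_refl_comp:
  assumes i: "i \<in> index_set S" and w: "w \<in> weyl S"
  shows "weyl_length S (refl S i \<circ> w) = weyl_length S w + 1
    \<or> weyl_length S (refl S i \<circ> w) + 1 = weyl_length S w"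
proof -
  have le: "weyl_length S (refl S i \<circ> w) \<le> weyl_length S w + 1" if w: "w \<in> weyl S" for w
    using ex_reduced_word[OF w] weyl_length_word_le[of "i # _"] i by fastforce
  have "refl S i \<circ> (refl S i \<circ> w) = w"
    using refl_involution[OF i] by (auto simp: fun_eq_iff)
  then have "weyl_length S w \<le> weyl_length S (refl S i \<circ> w) + 1"
    using le[OF refl_comp_in_weyl[OF i w]] by simp
  moreover have "weyl_length S (refl S i \<circ> w) \<noteq> weyl_length S w"
  proof -
    obtain js ks where jk: "set js \<subseteq> index_set S" "length js = weyl_length S w" "w = word js"
      "set ks \<subseteq> index_set S" "length ks = weyl_length S (refl S i \<circ> w)" "refl S i \<circ> w = word ks"
      using ex_reduced_word w refl_comp_in_weyl[OF i w] by metis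
    then have "even (length (i # js)) \<longleftrightarrow> even (length ks)"
      using i by (intro length_parity) auto
    then show ?thesis using jk(2,5) by auto
  qed
  ultimately show ?thesis using le[OF w] by linarith
qed

end

section \<open>Stabilizer and reflection subgroup of a weight\<close>

context hecke_parameters
begin

lemma weyl_stabilizer_iff:
  "w \<in> weyl_stabilizer S \<tau> \<longleftrightarrow> w \<in> weyl S \<and> (\<forall>\<nu>. \<tau> (w \<nu>) = \<tau> \<nu>)"
proof (cases "w \<in> weyl S")
  case True
  from weyl_bij[OF this] have "torus_act w \<tau> = \<tau> \<longleftrightarrow> (\<forall>\<nu>. \<tau> (w \<nu>) = \<tau> \<nu>)"
    unfolding torus_act_def fun_eq_iff by (metis bij_inv_eq_iff)
  then show ?thesis by (simp add: weyl_stabilizer_def)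
qed (simp add: weyl_stabilizer_def)

lemma reflection_subgroup_eq:
  assumes "\<tau> \<in> torus"
  shows "reflection_subgroup S \<sigma> \<sigma>' \<tau> = generated_group
    {w \<circ> refl S i \<circ> inv w | w i. w \<in> weyl S \<and> i \<in> index_set S \<and> singular i (\<tau> (w (coroot S i)))}"
proof -
  have "zeta_den_vanishes \<tau> (fract_act w (zeta_simple S \<sigma> \<sigma>' i)) \<longleftrightarrow> singular i (\<tau> (w (coroot S i)))"
    if "w \<in> weyl S" "i \<in> index_set S" for w i
    using that zeta_den_vanishes_iff weyl_additive weyl_bij assms by (simp add: bij_is_inj)
  then show ?thesis
    unfolding reflection_subgroup_def coroots_def
    by (intro arg_cong[where f = generated_group]) blast
qed

text \<open>From an odd value \<open>2 k + 1\<close>, subtracting \<open>k\<close> times the coroot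
  leaves the value \<open>1\<close>; then the root maps onto the integers, which forces equal
  parameters.\<close>

lemma even_pairing_root:
  assumes i: "i \<in> index_set S" and ne: "\<sigma> i \<noteq> \<sigma>' i"
  shows "even (pairing S (root S i) \<nu>)"
proof (rule ccontr)
  assume "odd (pairing S (root S i) \<nu>)"
  then obtain k where k: "pairing S (root S i) \<nu> = 2 * k + 1" by (elim oddE)
  define y where "y = \<nu> - k \<cdot>\<^sub>\<int> coroot S i"
  have "pairing S (root S i) y = 1"
    using k by (simp add: y_def pairing_diff pairing_zscale pairing_root_coroot[OF i])
  then have "z = pairing S (root S i) (z \<cdot>\<^sub>\<int> y)" for z
    by (simp add: pairing_zscale)
  then have "range (pairing S (root S i)) = UNIV" by blast
  then show False using sigma_eq[OF i] ne by blast
qed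

text \<open>The reflection moves \<open>\<nu>\<close> by \<open>n\<close> times the coroot. If the
  parameters differ, singularity only says that \<open>\<tau>\<close> is \<open>1\<close> or
  \<open>-1\<close> at the coroot, but then \<open>n\<close> is even.\<close>

lemma singular_reflection_fixes:
  assumes \<tau>: "\<tau> \<in> torus" and w: "w \<in> weyl S" and i: "i \<in> index_set S"
    and sing: "singular i (\<tau> (w (coroot S i)))"
  shows "\<tau> ((w \<circ> refl S i \<circ> inv w) \<nu>) = \<tau> \<nu>"
proof -
  define n where "n = pairing S (root S i) (inv w \<nu>)"
  have "(w \<circ> refl S i \<circ> inv w) \<nu> = \<nu> - n \<cdot>\<^sub>\<int> w (coroot S i)"
    using weyl_bij[OF w] additive.diff[OF weyl_additive[OF w]] additive_zscale[OF weyl_additive[OF w]]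
    by (simp add: refl_def n_def bij_is_surj surj_f_inv_f)
  moreover have "\<tau> (n \<cdot>\<^sub>\<int> w (coroot S i)) = 1"
  proof (cases "\<sigma> i = \<sigma>' i")
    case True
    then show ?thesis using sing torus_zscale_eq_1[OF \<tau>] by (simp add: singular_def)
  next
    case False
    then obtain k where "n = k * 2"
      using even_pairing_root[OF i] unfolding n_def by (metis evenE mult.commute)
    then have "n \<cdot>\<^sub>\<int> w (coroot S i) = k \<cdot>\<^sub>\<int> (w (coroot S i) + w (coroot S i))"
      by (simp add: zscale_2 flip: zmod.scale_scale)
    moreover have "\<tau> (w (coroot S i) + w (coroot S i)) = 1"
      using sing False by (simp add: singular_def torus_add[OF \<tau>] power2_eq_square)
    ultimately show ?thesis using torus_zscale_eq_1[OF \<tau>] by simp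
  qed
  ultimately show ?thesis by (simp add: torus_diff[OF \<tau>])
qed

lemma reflection_subgroup_subset:
  assumes \<tau>: "\<tau> \<in> torus"
  shows "reflection_subgroup S \<sigma> \<sigma>' \<tau> \<subseteq> weyl_stabilizer S \<tau>"
proof
  fix g assume "g \<in> reflection_subgroup S \<sigma> \<sigma>' \<tau>"
  then show "g \<in> weyl_stabilizer S \<tau>"
    unfolding reflection_subgroup_eq[OF \<tau>]
  proof induction
    case gen_id
    show ?case unfolding weyl_stabilizer_iff by (intro conjI id_in_weyl) simp
  next
    case (gen_base g)
    then obtain w i where g: "g = w \<circ> refl S i \<circ> inv w" and w: "w \<in> weyl S" "i \<in> index_set S"
      and "singular i (\<tau> (w (coroot S i)))" by blast
    then have "\<tau> (g \<nu>) = \<tau> \<nu>" for \<nu>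
      using singular_reflection_fixes[OF \<tau>] by blast
    moreover have "g \<in> weyl S"
      using w refl_in_weyl unfolding g weyl_def by (intro gen_comp gen_inv) (auto simp: weyl_def)
    ultimately show ?case by (simp add: weyl_stabilizer_iff)
  next
    case (gen_comp f g)
    then show ?case
      unfolding weyl_stabilizer_iff weyl_def by (auto intro: generated_group.gen_comp)
  next
    case (gen_inv f)
    then have "bij f" using weyl_bij by (auto simp: weyl_stabilizer_iff)
    then have "\<tau> (inv f \<nu>) = \<tau> \<nu>" if "\<forall>\<nu>. \<tau> (f \<nu>) = \<tau> \<nu>" for \<nu>
      using that by (metis bij_inv_eq_iff)
    then show ?case
      using gen_inv unfolding weyl_stabilizer_iff weyl_def by (auto intro: generated_group.gen_inv)
  qed
qed

text \<open>
  In a word of minimal length representing an element of \<open>W\<^sub>\<tau> - W\<^sub>(\<^sub>\<tau>\<^sub>)\<close>, a letter at which the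
  intertwining element is singular could be deleted by multiplying with a reflection of
  \<open>W\<^sub>(\<^sub>\<tau>\<^sub>)\<close>.
\<close>
lemma ex_nonsingular_word:
  assumes \<tau>: "\<tau> \<in> torus" and ne: "weyl_stabilizer S \<tau> \<noteq> reflection_subgroup S \<sigma> \<sigma>' \<tau>"
  shows "\<exists>js. set js \<subseteq> index_set S \<and> word js \<in> weyl_stabilizer S \<tau> \<and> js \<noteq> [] \<and>
    weyl_length S (word js) = length js \<and>
    (\<forall>xs j ys. js = xs @ j # ys \<longrightarrow> \<not> singular j (\<tau> (word (rev ys) (coroot S j))))"
proof -
  let ?R = "reflection_subgroup S \<sigma> \<sigma>' \<tau>"
  define P where "P w \<longleftrightarrow> w \<in> weyl_stabilizer S \<tau> \<and> w \<notin> ?R" for w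
  obtain w0 where "P w0"
    using ne reflection_subgroup_subset[OF \<tau>] unfolding P_def by blast
  then obtain w where w: "P w" and min: "\<And>v. P v \<Longrightarrow> weyl_length S w \<le> weyl_length S v"
    using exists_least_iff[of "\<lambda>n. \<exists>v. P v \<and> weyl_length S v = n"]
    by (metis linorder_not_less)
  obtain js where js: "set js \<subseteq> index_set S" "length js = weyl_length S w" "w = word js"
    using ex_reduced_word[of w] w unfolding P_def weyl_stabilizer_iff by blast
  have "js \<noteq> []"
  proof
    assume "js = []"
    then have "w \<in> ?R" using js(3) by (simp add: reflection_subgroup_def gen_id)
    then show False using w by (simp add: P_def)
  qed
  moreover have "\<not> singular j (\<tau> (word (rev ys) (coroot S j)))" if split: "js = xs @ j # ys" for xs j ys
  proof
    assume sing: "singular j (\<tau> (word (rev ys) (coroot S j)))"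
    have I: "set xs \<subseteq> index_set S" "j \<in> index_set S" "set ys \<subseteq> index_set S"
      using js(1) split by auto
    \<comment> \<open>The reflection in the coroot \<open>word (rev ys) (coroot S j)\<close>:
      composed on the right of \<open>w\<close>, it cancels the tail and the letter
      \<open>j\<close>, then restores the tail.\<close>
    define r where "r = word (rev ys) \<circ> refl S j \<circ> inv (word (rev ys))"
    have rW: "word (rev ys) \<in> weyl S" using I(3) by (intro word_in_weyl) simp
    have r: "r \<in> ?R"
      unfolding reflection_subgroup_eq[OF \<tau>]
      by (rule gen_base) (use I(2) rW sing in \<open>auto simp: r_def\<close>)
    have r_eq: "r \<nu> = word (rev ys) (refl S j (word ys \<nu>))" for \<nu>
      using inv_word[of "rev ys"] I(3) by (simp add: r_def)
    have rr: "r (r \<nu>) = \<nu>" for \<nu>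
      using I by (simp add: r_eq word_rev word_rev' refl_involution)
    have wr: "w \<circ> r = word (xs @ ys)"
      using I by (simp add: fun_eq_iff js(3) split r_eq word_append word_rev' refl_involution)
    have "w \<circ> r \<in> weyl_stabilizer S \<tau>"
      unfolding weyl_stabilizer_iff
    proof
      show "w \<circ> r \<in> weyl S"
        unfolding wr using I by (intro word_in_weyl) auto
      have "r \<in> weyl_stabilizer S \<tau>" using r reflection_subgroup_subset[OF \<tau>] by blast
      then show "\<forall>\<nu>. \<tau> ((w \<circ> r) \<nu>) = \<tau> \<nu>"
        using w by (simp add: P_def weyl_stabilizer_iff)
    qed
    moreover have "w \<circ> r \<notin> ?R"
    proof
      assume "w \<circ> r \<in> ?R"
      then have "(w \<circ> r) \<circ> r \<in> ?R"
        using r unfolding reflection_subgroup_def by (rule gen_comp)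
      moreover have "(w \<circ> r) \<circ> r = w" using rr by (simp add: fun_eq_iff)
      ultimately show False using w by (simp add: P_def)
    qed
    ultimately have "weyl_length S w \<le> weyl_length S (w \<circ> r)"
      by (intro min) (simp add: P_def)
    moreover have "weyl_length S (w \<circ> r) \<le> length (xs @ ys)"
      unfolding wr using I by (intro weyl_length_word_le) auto
    ultimately show False using js(2) split by simp
  qed
  moreover have "word js \<in> weyl_stabilizer S \<tau>" using w js(3) by (simp add: P_def)
  ultimately show ?thesis using js by auto
qed

end

section \<open>The Bernstein--Lusztig--Hecke algebra\<close>

sublocale bernstein_lusztig_hecke \<subseteq> complex_algebra scale
  by unfold_locales (fact mult_scale_left, fact mult_scale_right)

lemma (in root_generating_system) countable_weyl: "countable (weyl S)"
proof (rule countable_subset)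
  show "weyl S \<subseteq> word ` lists (index_set S)"
    unfolding lists_eq_set by (auto simp: weyl_iff)
  show "countable (word ` lists (index_set S))"
    using finite_index by (intro countable_image countable_lists countable_finite)
qed

lemma countable_free_ab_group: "countable (UNIV :: 'y::free_ab_group_fin_rank set)"
proof -
  obtain B :: "'y set" where B: "finite B"
    and ex1: "\<And>x. \<exists>!c. (\<forall>b. b \<notin> B \<longrightarrow> c b = 0) \<and> x = (\<Sum>b\<in>B. c b \<cdot>\<^sub>\<int> b)"
    using ex_finite_zbasis by blast
  have "countable (range (\<lambda>c :: 'y \<Rightarrow> int. \<Sum>b\<in>B. c b \<cdot>\<^sub>\<int> b))"
    using B
  proof induction
    case (insert b B)
    let ?R = "range (\<lambda>c :: 'y \<Rightarrow> int. \<Sum>b\<in>B. c b \<cdot>\<^sub>\<int> b)"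
    have "range (\<lambda>c :: 'y \<Rightarrow> int. \<Sum>a\<in>insert b B. c a \<cdot>\<^sub>\<int> a)
        \<subseteq> (\<lambda>(n, y). n \<cdot>\<^sub>\<int> b + y) ` (UNIV \<times> ?R)"
    proof
      fix x assume "x \<in> range (\<lambda>c :: 'y \<Rightarrow> int. \<Sum>a\<in>insert b B. c a \<cdot>\<^sub>\<int> a)"
      then obtain c :: "'y \<Rightarrow> int" where "x = c b \<cdot>\<^sub>\<int> b + (\<Sum>a\<in>B. c a \<cdot>\<^sub>\<int> a)"
        using insert.hyps by auto
      then show "x \<in> (\<lambda>(n, y). n \<cdot>\<^sub>\<int> b + y) ` (UNIV \<times> ?R)"
        by (intro image_eqI[where x = "(c b, \<Sum>a\<in>B. c a \<cdot>\<^sub>\<int> a)"]) auto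
    qed
    moreover have "countable (UNIV \<times> ?R :: (int \<times> 'y) set)"
      using insert.IH by (intro countable_SIGMA) auto
    ultimately show ?case using countable_subset[OF _ countable_image] by blast
  qed simp
  moreover have "x \<in> range (\<lambda>c. \<Sum>b\<in>B. c b \<cdot>\<^sub>\<int> b)" for x
    using ex1[of x] by blast
  then have "UNIV = range (\<lambda>c :: 'y \<Rightarrow> int. \<Sum>b\<in>B. c b \<cdot>\<^sub>\<int> b)" by blast
  ultimately show ?thesis by simp
qed

context bernstein_lusztig_hecke
begin

lemma basis_induct [consumes 0, case_names add scale basis]:
  assumes add: "\<And>x y. P x \<Longrightarrow> P y \<Longrightarrow> P (x + y)" and scale: "\<And>c x. P x \<Longrightarrow> P (scale c x)"
    and basis: "\<And>\<nu> w. w \<in> weyl S \<Longrightarrow> P (ZH \<nu> w)"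
  shows "P x"
proof -
  have "x \<in> span ((\<lambda>(\<nu>, w). ZH \<nu> w) ` (UNIV \<times> weyl S))"
    using basis_span by simp
  then show ?thesis
  proof (induction rule: span_induct_alt)
    case base
    show ?case using scale[OF basis[OF id_in_weyl], of 0] by simp
  qed (use assms in auto)
qed

lemma ZH_id_one: "ZH 0 id = 1"
proof -
  have "ZH 0 id * x = x" for x
  proof (induction x rule: basis_induct)
    case (basis \<nu> w)
    then show ?case
      by (metis Z_mult_H Z_mult_Z add_0 mult.assoc)
  qed (simp_all add: distrib_left mult_scale_right)
  from this[of 1] show ?thesis by simp
qed

lemma Z_mult_ZH: "w \<in> weyl S \<Longrightarrow> ZH \<nu> id * ZH \<mu> w = ZH (\<nu> + \<mu>) w"
  by (metis Z_mult_H Z_mult_Z mult.assoc)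

lemma algebra_embed_mult: "algebra_embed scale ZH f * x
    = (\<Sum>\<nu>\<in>support f. scale (Defs.coeff f \<nu>) (ZH \<nu> id * x))"
  by (simp add: algebra_embed_def sum_distrib_right mult_scale_left)

lemma mult_algebra_embed: "x * algebra_embed scale ZH f
    = (\<Sum>\<nu>\<in>support f. scale (Defs.coeff f \<nu>) (x * ZH \<nu> id))"
  by (simp add: algebra_embed_def sum_distrib_left mult_scale_right)

text \<open>For length estimates only this shape counts: the correction lies in the group algebra
  and does not raise the length.\<close>

lemma bernstein_expand:
  assumes "i \<in> index_set S"
  obtains f where "ZH 0 (refl S i) * ZH \<nu> id
    = ZH (refl S i \<nu>) id * ZH 0 (refl S i) + algebra_embed scale ZH f"
  using bernstein[OF assms, of \<nu>] by (auto simp: algebra_simps)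

section \<open>Length filtration and the two orders of the basis\<close>

definition filtration :: "nat \<Rightarrow> 'h set"
  where "filtration n = span {ZH \<nu> w | \<nu> w. w \<in> weyl S \<and> weyl_length S w < n}"

lemma ZH_in_filtration: "w \<in> weyl S \<Longrightarrow> weyl_length S w < n \<Longrightarrow> ZH \<nu> w \<in> filtration n"
  unfolding filtration_def by (intro span_base) blast

lemma subspace_filtration: "subspace (filtration n)"
  by (simp add: filtration_def)

lemma filtration_mono: "m \<le> n \<Longrightarrow> filtration m \<subseteq> filtration n"
  unfolding filtration_def by (intro span_mono) (blast intro: less_le_trans)

lemma filtration_induct [consumes 1, case_names zero add scale basis]:
  assumes x: "x \<in> filtration n" and zero: "P 0"
    and add: "\<And>x y. P x \<Longrightarrow> P y \<Longrightarrow> P (x + y)" and scale: "\<And>c x. P x \<Longrightarrow> P (scale c x)"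
    and basis: "\<And>\<nu> w. w \<in> weyl S \<Longrightarrow> weyl_length S w < n \<Longrightarrow> P (ZH \<nu> w)"
  shows "P x"
  using x unfolding filtration_def
  by (induction rule: span_induct_alt) (use assms in auto)

lemma ex_filtration: "\<exists>n. x \<in> filtration n"
proof (induction x rule: basis_induct)
  case (add x y)
  then obtain m n where "x \<in> filtration m" "y \<in> filtration n" by blast
  then have "x \<in> filtration (max m n)" "y \<in> filtration (max m n)"
    using filtration_mono[of _ "max m n"] by (meson max.cobounded1 max.cobounded2 subsetD)+
  then show ?case using subspace_add[OF subspace_filtration] by blast
next
  case (scale c x)
  then show ?case using subspace_scale[OF subspace_filtration] by blast
next
  case (basis \<nu> w)
  then show ?case using ZH_in_filtration by blast
qed

lemma Z_mult_filtration: "x \<in> filtration n \<Longrightarrow> ZH \<nu> id * x \<in> filtration n"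
proof (induction rule: filtration_induct)
  case (add x y)
  then show ?case by (simp add: distrib_left subspace_add[OF subspace_filtration])
next
  case (scale c x)
  then show ?case by (simp add: mult_scale_right subspace_scale[OF subspace_filtration])
next
  case (basis \<mu> w)
  then have "ZH \<nu> id * ZH \<mu> w \<in> filtration n" by (simp add: Z_mult_ZH ZH_in_filtration)
  then show ?case by (simp only: id_def)
qed (simp add: subspace_0[OF subspace_filtration])

lemma algebra_embed_mult_filtration:
  "x \<in> filtration n \<Longrightarrow> algebra_embed scale ZH f * x \<in> filtration n"
  unfolding algebra_embed_mult
  by (intro subspace_sum[OF subspace_filtration] subspace_scale[OF subspace_filtration]
      Z_mult_filtration)

lemma H_mult_H:
  assumes "i \<in> index_set S" "w \<in> weyl S"
  shows "\<exists>c. ZH 0 (refl S i) * ZH 0 w = ZH 0 (refl S i \<circ> w) + scale c (ZH 0 w)"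
  using weyl_length_refl_comp[OF assms]
proof
  assume "weyl_length S (refl S i \<circ> w) = weyl_length S w + 1"
  then show ?thesis using H_mult_up[OF assms] by (intro exI[of _ 0]) simp
next
  assume "weyl_length S (refl S i \<circ> w) + 1 = weyl_length S w"
  then show ?thesis using H_mult_down[OF assms] by (metis add.commute)
qed

lemma H_mult_filtration:
  assumes i: "i \<in> index_set S"
  shows "x \<in> filtration n \<Longrightarrow> ZH 0 (refl S i) * x \<in> filtration (Suc n)"
proof (induction rule: filtration_induct)
  case (add x y)
  then show ?case by (simp add: distrib_left subspace_add[OF subspace_filtration])
next
  case (scale c x)
  then show ?case by (simp add: mult_scale_right subspace_scale[OF subspace_filtration])
next
  case (basis \<nu> w)
  obtain f where f: "ZH 0 (refl S i) * ZH \<nu> id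
      = ZH (refl S i \<nu>) id * ZH 0 (refl S i) + algebra_embed scale ZH f"
    using bernstein_expand[OF i] .
  have "ZH 0 (refl S i) * ZH \<nu> w = (ZH 0 (refl S i) * ZH \<nu> id) * ZH 0 w"
    using basis(1) by (simp add: mult.assoc Z_mult_H)
  also have "\<dots> = ZH (refl S i \<nu>) id * (ZH 0 (refl S i) * ZH 0 w) + algebra_embed scale ZH f * ZH 0 w"
    by (simp add: f distrib_right mult.assoc)
  also have "\<dots> \<in> filtration (Suc n)"
  proof -
    obtain c where c: "ZH 0 (refl S i) * ZH 0 w = ZH 0 (refl S i \<circ> w) + scale c (ZH 0 w)"
      using H_mult_H[OF i basis(1)] by blast
    have len: "weyl_length S (refl S i \<circ> w) < Suc n"
      using weyl_length_refl_comp[OF i basis(1)] basis(2) by auto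
    show ?thesis
      unfolding c using basis len refl_comp_in_weyl[OF i basis(1)]
      by (intro subspace_add[OF subspace_filtration] subspace_scale[OF subspace_filtration]
          Z_mult_filtration algebra_embed_mult_filtration ZH_in_filtration) auto
  qed
  finally show ?case .
qed (simp add: subspace_0[OF subspace_filtration])

lemma reduced_Cons:
  assumes "set (j # js) \<subseteq> index_set S" "weyl_length S (word (j # js)) = length (j # js)"
  shows "weyl_length S (word js) = length js"
    "ZH 0 (refl S j) * ZH 0 (word js) = ZH 0 (word (j # js))"
proof -
  have I: "j \<in> index_set S" "set js \<subseteq> index_set S" using assms(1) by auto
  show len: "weyl_length S (word js) = length js"
    using weyl_length_refl_comp[OF I(1) word_in_weyl[OF I(2)]] weyl_length_word_le[OF I(2)] assms(2)
    by auto
  show "ZH 0 (refl S j) * ZH 0 (word js) = ZH 0 (word (j # js))"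
    using H_mult_up[OF I(1) word_in_weyl[OF I(2)]] len assms(2) by simp
qed

text \<open>Each letter, moved past a power of \<open>Z\<close>, acts on the exponent and leaves a
  correction without that letter, hence of smaller length.\<close>

lemma H_mult_Z_reduced:
  "set js \<subseteq> index_set S \<Longrightarrow> weyl_length S (word js) = length js \<Longrightarrow>
    ZH 0 (word js) * ZH \<nu> id - ZH (word js \<nu>) (word js) \<in> filtration (length js)"
proof (induction js)
  case Nil
  have "ZH 0 id * ZH \<nu> id - ZH \<nu> id \<in> filtration 0"
    by (simp add: ZH_id_one subspace_0[OF subspace_filtration])
  then show ?case by (simp add: id_def)
next
  case (Cons j js)
  let ?w = "word js"
  have I: "j \<in> index_set S" "set js \<subseteq> index_set S" using Cons.prems by auto
  note red = reduced_Cons[OF Cons.prems]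
  define y where "y = ZH 0 ?w * ZH \<nu> id - ZH (?w \<nu>) ?w"
  have y: "y \<in> filtration (length js)"
    using Cons.IH I(2) red(1) by (simp add: y_def id_def)
  obtain f where f: "ZH 0 (refl S j) * ZH (?w \<nu>) id
      = ZH (refl S j (?w \<nu>)) id * ZH 0 (refl S j) + algebra_embed scale ZH f"
    using bernstein_expand[OF I(1)] .
  have "ZH 0 (word (j # js)) * ZH \<nu> id = ZH 0 (refl S j) * (ZH 0 ?w * ZH \<nu> id)"
    by (simp only: mult.assoc flip: red(2))
  also have "\<dots> = (ZH 0 (refl S j) * ZH (?w \<nu>) id) * ZH 0 ?w + ZH 0 (refl S j) * y"
    by (simp add: y_def distrib_left right_diff_distrib mult.assoc Z_mult_H word_in_weyl[OF I(2)])
  also have "\<dots> = ZH (refl S j (?w \<nu>)) id * ZH 0 (word (j # js))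
      + (algebra_embed scale ZH f * ZH 0 ?w + ZH 0 (refl S j) * y)"
    by (simp only: f distrib_right mult.assoc red(2) add.assoc)
  also have "ZH (refl S j (?w \<nu>)) id * ZH 0 (word (j # js)) = ZH (word (j # js) \<nu>) (word (j # js))"
    using Z_mult_H[OF word_in_weyl[OF Cons.prems(1)]] by simp
  finally have "ZH 0 (word (j # js)) * ZH \<nu> id - ZH (word (j # js) \<nu>) (word (j # js))
      = algebra_embed scale ZH f * ZH 0 ?w + ZH 0 (refl S j) * y"
    by (simp add: id_def comp_def)
  also have "\<dots> \<in> filtration (Suc (length js))"
    using H_mult_filtration[OF I(1) y] red(1) word_in_weyl[OF I(2)]
    by (intro subspace_add[OF subspace_filtration] algebra_embed_mult_filtration ZH_in_filtration) auto
  finally show ?case by (simp add: id_def comp_def)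
qed

lemma H_mult_Z:
  assumes "w \<in> weyl S"
  shows "ZH 0 w * ZH \<nu> id - ZH (w \<nu>) w \<in> filtration (weyl_length S w)"
  using ex_reduced_word[OF assms] H_mult_Z_reduced by metis

lemma ex_linear_on_basis:
  "\<exists>U. Vector_Spaces.linear scale scale U \<and> (\<forall>\<nu>. \<forall>w\<in>weyl S. U (ZH \<nu> w) = g \<nu> w)"
proof -
  interpret vs: vector_space_pair scale scale ..
  let ?b = "\<lambda>(\<nu>, w). ZH \<nu> w" and ?A = "UNIV \<times> weyl S"
  obtain U where U: "Vector_Spaces.linear scale scale U"
    "\<forall>x\<in>?b ` ?A. U x = (\<lambda>(\<nu>, w). g \<nu> w) (the_inv_into ?A ?b x)"
    using vs.linear_independent_extend[OF basis_independent,
        of "\<lambda>x. (\<lambda>(\<nu>, w). g \<nu> w) (the_inv_into ?A ?b x)"] by blast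
  have "U (ZH \<nu> w) = g \<nu> w" if "w \<in> weyl S" for \<nu> w
  proof -
    have "U (?b (\<nu>, w)) = (\<lambda>(\<nu>, w). g \<nu> w) (the_inv_into ?A ?b (?b (\<nu>, w)))"
      using U(2) that by blast
    then show ?thesis
      using the_inv_into_f_f[OF basis_inj, of "(\<nu>, w)"] that by simp
  qed
  with U(1) show ?thesis by blast
qed

text \<open>
  The change from the basis \<open>Z\<^sup>\<nu> H\<^sub>w\<close> to \<open>H\<^sub>w Z\<^sup>\<nu>\<close> is unitriangular for the length filtration.
\<close>
lemma ex_right_basis_change:
  obtains U where "Vector_Spaces.linear scale scale U" "bij U"
    "\<And>\<nu> w. w \<in> weyl S \<Longrightarrow> U (ZH (w \<nu>) w) = ZH 0 w * ZH \<nu> id"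
proof -
  obtain U where U: "Vector_Spaces.linear scale scale U"
    and Ub: "\<And>\<nu> w. w \<in> weyl S \<Longrightarrow> U (ZH \<nu> w) = ZH 0 w * ZH (inv w \<nu>) id"
    using ex_linear_on_basis[of "\<lambda>\<nu> w. ZH 0 w * ZH (inv w \<nu>) id"] by blast
  interpret U: Vector_Spaces.linear scale scale U by (rule U)
  have tri: "U x - x \<in> filtration n" if "x \<in> filtration (Suc n)" for x n
    using that
  proof (induction rule: filtration_induct)
    case (add x y)
    then show ?case
      using subspace_add[OF subspace_filtration add] by (simp add: U.add algebra_simps)
  next
    case (scale c x)
    then show ?case
      using subspace_scale[OF subspace_filtration scale]
      by (simp add: U.scale scale_right_diff_distrib)
  next
    case (basis \<nu> w)
    then have "U (ZH \<nu> w) - ZH \<nu> w \<in> filtration (weyl_length S w)"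
      using H_mult_Z[OF basis(1), of "inv w \<nu>"] Ub[OF basis(1)] weyl_bij[OF basis(1)]
      by (simp add: bij_is_surj surj_f_inv_f)
    then show ?case using filtration_mono[of "weyl_length S w" n] basis(2) by auto
  qed (simp add: subspace_0[OF subspace_filtration])
  \<comment> \<open>The strict bound in the filtration makes its first step zero, which anchors both
    inductions.\<close>
  have F0: "filtration 0 = {0}"
    by (simp add: filtration_def)
  \<comment> \<open>If \<open>U x = 0\<close>, then \<open>- x = U x - x\<close> lies one step
    lower. Surjectivity uses \<open>x = U x - (U x - x)\<close> in the same way.\<close>
  have ker: "x = 0" if "x \<in> filtration n" "U x = 0" for x n
    using that
  proof (induction n)
    case (Suc n)
    then have "- x \<in> filtration n" using tri[of x n] by simp
    then have "x \<in> filtration n" using subspace_neg[OF subspace_filtration] by fastforce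
    then show ?case using Suc by simp
  qed (simp add: F0)
  have "inj U"
  proof (rule injI)
    fix x y assume "U x = U y"
    then have "U (x - y) = 0" by (simp add: U.diff)
    then have "x - y = 0" using ker ex_filtration by blast
    then show "x = y" by simp
  qed
  moreover have ran: "x \<in> range U" if "x \<in> filtration n" for x n
    using that
  proof (induction n arbitrary: x)
    case 0
    then have "x = U 0" by (simp add: F0)
    then show ?case by blast
  next
    case (Suc n)
    then obtain y where "U x - x = U y" using tri by blast
    then have "x = U (x - y)" by (simp add: U.diff algebra_simps)
    then show ?case by blast
  qed
  then have "surj U" using ex_filtration by blast
  ultimately have "bij U" by (simp add: bij_def)
  moreover have "U (ZH (w \<nu>) w) = ZH 0 w * ZH \<nu> id" if "w \<in> weyl S" for \<nu> w
    using Ub[OF that] weyl_bij[OF that] by (simp add: bij_is_inj)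
  ultimately show thesis using that U by blast
qed

section \<open>The left ideal whose quotient is the principal series\<close>

definition weight_ideal :: "('y \<Rightarrow> complex) \<Rightarrow> 'h set"
  where "weight_ideal \<tau> = span {h * (ZH \<kappa> id - scale (\<tau> \<kappa>) 1) | h \<kappa>. True}"

lemma weight_ideal_induct [consumes 1, case_names zero add scale generator]:
  assumes x: "x \<in> weight_ideal \<tau>" and zero: "P 0"
    and add: "\<And>x y. P x \<Longrightarrow> P y \<Longrightarrow> P (x + y)" and scale: "\<And>c x. P x \<Longrightarrow> P (scale c x)"
    and gen: "\<And>h \<kappa>. P (h * (ZH \<kappa> id - scale (\<tau> \<kappa>) 1))"
  shows "P x"
  using x unfolding weight_ideal_def
  by (induction rule: span_induct_alt) (use assms in auto)

lemma generator_in_weight_ideal: "h * (ZH \<kappa> id - scale (\<tau> \<kappa>) 1) \<in> weight_ideal \<tau>"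
  unfolding weight_ideal_def by (intro span_base) blast

lemma left_ideal_weight_ideal: "left_ideal (weight_ideal \<tau>)"
  unfolding left_ideal_def
proof (intro conjI ballI allI)
  show "0 \<in> weight_ideal \<tau>"
    by (simp add: weight_ideal_def span_zero)
  show "x + y \<in> weight_ideal \<tau>" if "x \<in> weight_ideal \<tau>" "y \<in> weight_ideal \<tau>" for x y
    using that unfolding weight_ideal_def by (rule span_add)
  show "h * x \<in> weight_ideal \<tau>" if "x \<in> weight_ideal \<tau>" for h x
    using that
  proof (induction rule: weight_ideal_induct)
    case (generator g \<kappa>)
    show ?case using generator_in_weight_ideal[of "h * g"] by (simp add: mult.assoc)
  qed (simp_all add: distrib_left mult_scale_right weight_ideal_def span_zero span_add span_scale)
qed

lemma weight_ideal_balanced: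
  "x * algebra_embed scale ZH f - scale (eval_at \<tau> f) x \<in> weight_ideal \<tau>"
proof -
  have "x * algebra_embed scale ZH f - scale (eval_at \<tau> f) x
      = (\<Sum>\<nu>\<in>support f. scale (Defs.coeff f \<nu>) (x * (ZH \<nu> id - scale (\<tau> \<nu>) 1)))"
    by (simp add: mult_algebra_embed eval_at_def scale_sum_left sum_subtractf scale_right_diff_distrib
        right_diff_distrib mult_scale_right)
  also have "\<dots> \<in> weight_ideal \<tau>"
    by (intro left_ideal_sum left_ideal_weight_ideal left_ideal_scale generator_in_weight_ideal)
  finally show ?thesis .
qed

text \<open>The coefficient of \<open>H\<^sub>w\<close> in the basis \<open>(H\<^sub>v \<otimes> 1)\<close> of \<open>I\<^sub>\<tau>\<close>.\<close>
lemma ex_coefficient_functional: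
  assumes \<tau>: "\<tau> \<in> torus"
  obtains \<Theta> where "Vector_Spaces.linear scale scale \<Theta>" "\<And>x. x \<in> weight_ideal \<tau> \<Longrightarrow> \<Theta> x = 0"
    "\<And>v. v \<in> weyl S \<Longrightarrow> \<Theta> (ZH 0 v) = (if v = w then 1 else 0)"
proof -
  obtain U where U: "Vector_Spaces.linear scale scale U" "bij U"
    and Ub: "\<And>\<nu> v. v \<in> weyl S \<Longrightarrow> U (ZH (v \<nu>) v) = ZH 0 v * ZH \<nu> id"
    using ex_right_basis_change by blast
  interpret U: Vector_Spaces.linear scale scale U by (rule U(1))
  \<comment> \<open>Transported by \<open>U\<close>, this sends \<open>H_v Z^\<nu>\<close> to
    \<open>\<tau>(\<nu>)\<close> for \<open>v = w\<close> and to \<open>0\<close> otherwise. Scalars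
    are represented by multiples of \<open>1\<close>.\<close>
  obtain \<theta> where \<theta>: "Vector_Spaces.linear scale scale \<theta>"
    and \<theta>b: "\<And>\<nu> v. v \<in> weyl S \<Longrightarrow> \<theta> (ZH \<nu> v) = (if v = w then scale (\<tau> (inv v \<nu>)) 1 else 0)"
    using ex_linear_on_basis[of "\<lambda>\<nu> v. if v = w then scale (\<tau> (inv v \<nu>)) 1 else 0"] by blast
  interpret \<theta>: Vector_Spaces.linear scale scale \<theta> by (rule \<theta>)
  define \<Theta> where "\<Theta> = \<theta> \<circ> inv U"
  have \<Theta>U: "\<Theta> (U x) = \<theta> x" for x
    using U(2) by (simp add: \<Theta>_def bij_is_inj)
  have Uex: "\<exists>y. x = U y" for x
    using U(2) by (metis bij_pointE)
  interpret vs: vector_space_pair scale scale ..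
  have lin: "Vector_Spaces.linear scale scale \<Theta>"
    unfolding Vector_Spaces.linear_iff
  proof (intro conjI allI)
    fix x y c
    obtain x' y' where xy: "x = U x'" "y = U y'" using Uex by metis
    show "\<Theta> (x + y) = \<Theta> x + \<Theta> y"
      unfolding xy by (simp only: \<Theta>U \<theta>.add flip: U.add)
    show "\<Theta> (scale c x) = scale c (\<Theta> x)"
      unfolding xy by (simp only: \<Theta>U \<theta>.scale flip: U.scale)
  qed unfold_locales
  interpret \<Theta>: Vector_Spaces.linear scale scale \<Theta> by (rule lin)
  have \<Theta>b: "\<Theta> (ZH 0 v * ZH \<nu> id) = (if v = w then scale (\<tau> \<nu>) 1 else 0)" if "v \<in> weyl S" for v \<nu>
    using Ub[OF that, of \<nu>] \<Theta>U[of "ZH (v \<nu>) v"] \<theta>b[OF that, of "v \<nu>"]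
      inv_f_f[OF bij_is_inj[OF weyl_bij[OF that]], of \<nu>] by auto
  \<comment> \<open>With powers of \<open>Z\<close> on the right, a generator acts only on the
    exponent, and multiplicativity of \<open>\<tau>\<close> makes the two terms cancel.\<close>
  have gen: "\<Theta> (h * (ZH \<kappa> id - scale (\<tau> \<kappa>) 1)) = 0" for h \<kappa>
  proof -
    obtain x where h: "h = U x" using Uex by blast
    show ?thesis
      unfolding h
    proof (induction x rule: basis_induct)
      case (basis \<nu> v)
      define \<mu> where "\<mu> = inv v \<nu>"
      have "U (ZH \<nu> v) = ZH 0 v * ZH \<mu> id"
        using Ub[OF basis, of \<mu>] weyl_bij[OF basis] by (simp add: \<mu>_def bij_is_surj surj_f_inv_f)
      then have "U (ZH \<nu> v) * (ZH \<kappa> id - scale (\<tau> \<kappa>) 1)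
          = ZH 0 v * ZH (\<mu> + \<kappa>) id - scale (\<tau> \<kappa>) (ZH 0 v * ZH \<mu> id)"
        by (simp add: right_diff_distrib mult_scale_right mult.assoc Z_mult_Z)
      then have "\<Theta> (U (ZH \<nu> v) * (ZH \<kappa> id - scale (\<tau> \<kappa>) 1)) = 0"
        by (simp add: \<Theta>.diff \<Theta>.scale \<Theta>b[OF basis] torus_add[OF \<tau>] mult.commute)
      then show ?case by (simp only: id_def)
    qed (simp_all add: U.add U.scale distrib_right mult_scale_left \<Theta>.add \<Theta>.scale)
  qed
  have "\<Theta> x = 0" if "x \<in> weight_ideal \<tau>" for x
    using that by (induction rule: weight_ideal_induct) (simp_all add: gen \<Theta>.add \<Theta>.scale)
  moreover have "\<Theta> (ZH 0 v) = (if v = w then 1 else 0)" if "v \<in> weyl S" for v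
    using \<Theta>b[OF that, of 0] by (simp add: ZH_id_one torus_0[OF \<tau>])
  ultimately show thesis using that lin by blast
qed

section \<open>Weight vectors and intertwining elements\<close>

definition weight_vector :: "'h set \<Rightarrow> ('y \<Rightarrow> complex) \<Rightarrow> 'h \<Rightarrow> bool"
  where "weight_vector J \<chi> x \<longleftrightarrow> (\<forall>\<kappa>. ZH \<kappa> id * x - scale (\<chi> \<kappa>) x \<in> J)"

lemma weight_vector_algebra_embed:
  assumes J: "left_ideal J" and x: "weight_vector J \<chi> x"
  shows "algebra_embed scale ZH f * x - scale (eval_at \<chi> f) x \<in> J"
proof -
  have "algebra_embed scale ZH f * x - scale (eval_at \<chi> f) x
      = (\<Sum>\<nu>\<in>support f. scale (Defs.coeff f \<nu>) (ZH \<nu> id * x - scale (\<chi> \<nu>) x))"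
    by (simp add: algebra_embed_mult eval_at_def scale_sum_left sum_subtractf scale_right_diff_distrib)
  also have "\<dots> \<in> J"
    using x by (intro left_ideal_sum J left_ideal_scale[OF J]) (simp add: weight_vector_def)
  finally show ?thesis .
qed

text \<open>\<open>Q_i\<close> has no pole at \<open>\<chi>\<close>, so the Bernstein correction
  evaluates to its value there times a difference of characters, with one constant for all
  exponents.\<close>

lemma Q_fraction_value:
  assumes i: "i \<in> index_set S" and \<chi>: "\<chi> \<in> torus"
    and reg: "\<not> singular i (\<chi> (coroot S i))"
  shows "\<exists>q. \<forall>f \<nu> \<mu>. Fract f 1 = Q_fraction S \<sigma> \<sigma>' i * Fract (monomial 1 \<nu> - monomial 1 \<mu>) 1
    \<longrightarrow> eval_at \<chi> f = q * (\<chi> \<nu> - \<chi> \<mu>)"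
proof -
  define a b where "a = \<sigma> i - inverse (\<sigma> i)" and "b = \<sigma>' i - inverse (\<sigma>' i)"
  define X :: "'y group_algebra" where "X = monomial 1 (- coroot S i)"
  define z where "z = inverse (\<chi> (coroot S i))"
  have X: "eval_at \<chi> X = z"
    by (simp add: X_def z_def torus_minus[OF \<chi>])
  have D: "1 - monomial 1 (- (2 \<cdot>\<^sub>\<int> coroot S i)) = (1 - X) * (1 + X)"
    by (simp add: X_def zscale_2 monomial_mult algebra_simps)
  have D0: "(1 - X) * (1 + X) \<noteq> 0"
    using zeta_den_coroot_nonzero(2)[OF i] unfolding D[symmetric] zscale_2 .
  have P: "monomial a 0 + monomial b (- coroot S i) = monomial a 0 + monomial b 0 * X"
    by (simp add: X_def monomial_mult)
  have eq: "f * ((1 - X) * (1 + X)) = (monomial a 0 + monomial b 0 * X) * (monomial 1 \<nu> - monomial 1 \<mu>)"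
    if "Fract f 1 = Q_fraction S \<sigma> \<sigma>' i * Fract (monomial 1 \<nu> - monomial 1 \<mu>) 1" for f \<nu> \<mu>
    using that D0 unfolding Q_fraction_def D a_def[symmetric] b_def[symmetric] P
    by (simp add: eq_fract mult_fract)
  note ev = eval_at_mult[OF \<chi>] eval_at_add eval_at_diff eval_at_1[OF \<chi>] X torus_0[OF \<chi>]
  show ?thesis
  proof (cases "\<sigma> i = \<sigma>' i")
    case True
    then have "z \<noteq> 1" using reg by (simp add: singular_def z_def)
    have "eval_at \<chi> f = a / (1 - z) * (\<chi> \<nu> - \<chi> \<mu>)"
      if "Fract f 1 = Q_fraction S \<sigma> \<sigma>' i * Fract (monomial 1 \<nu> - monomial 1 \<mu>) 1" for f \<nu> \<mu>
    proof -
      \<comment> \<open>For equal parameters \<open>\<chi>\<close> may vanish at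
        \<open>1 + X\<close>, so this factor is cancelled in the group algebra before
        evaluating.\<close>
      have "(1 + X) * (f * (1 - X)) = (1 + X) * (monomial a 0 * (monomial 1 \<nu> - monomial 1 \<mu>))"
        using eq[OF that] True by (simp add: a_def b_def algebra_simps)
      then have "f * (1 - X) = monomial a 0 * (monomial 1 \<nu> - monomial 1 \<mu>)"
        using D0 by (metis mult_cancel_left mult_zero_right)
      then have "eval_at \<chi> (f * (1 - X)) = eval_at \<chi> (monomial a 0 * (monomial 1 \<nu> - monomial 1 \<mu>))"
        by simp
      then have "eval_at \<chi> f * (1 - z) = a * (\<chi> \<nu> - \<chi> \<mu>)" by (simp add: ev)
      then show ?thesis using \<open>z \<noteq> 1\<close> by (simp add: field_simps)
    qed
    then show ?thesis by blast
  next
    case False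
    then have "z\<^sup>2 \<noteq> 1" using reg by (simp add: singular_def z_def power_inverse)
    then have z: "(1 - z) * (1 + z) \<noteq> 0" by (simp add: power2_eq_square algebra_simps)
    have "eval_at \<chi> f = (a + b * z) / ((1 - z) * (1 + z)) * (\<chi> \<nu> - \<chi> \<mu>)"
      if "Fract f 1 = Q_fraction S \<sigma> \<sigma>' i * Fract (monomial 1 \<nu> - monomial 1 \<mu>) 1" for f \<nu> \<mu>
    proof -
      have "eval_at \<chi> (f * ((1 - X) * (1 + X)))
          = eval_at \<chi> ((monomial a 0 + monomial b 0 * X) * (monomial 1 \<nu> - monomial 1 \<mu>))"
        using eq[OF that] by simp
      then have "eval_at \<chi> f * ((1 - z) * (1 + z)) = (a + b * z) * (\<chi> \<nu> - \<chi> \<mu>)" by (simp add: ev)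
      then show ?thesis using z by (metis nonzero_mult_div_cancel_right times_divide_eq_left)
    qed
    then show ?thesis by blast
  qed
qed

text \<open>The constant \<open>q\<close> is the value of \<open>Q\<^sub>i\<close> at \<open>\<chi>\<close>.\<close>
lemma weight_vector_intertwine:
  assumes J: "left_ideal J" and i: "i \<in> index_set S" and \<chi>: "\<chi> \<in> torus"
    and reg: "\<not> singular i (\<chi> (coroot S i))" and x: "weight_vector J \<chi> x"
  shows "\<exists>q. weight_vector J (\<chi> \<circ> refl S i) (ZH 0 (refl S i) * x - scale q x)"
proof -
  obtain q where q: "\<And>f \<nu> \<mu>. Fract f 1 = Q_fraction S \<sigma> \<sigma>' i * Fract (monomial 1 \<nu> - monomial 1 \<mu>) 1
      \<Longrightarrow> eval_at \<chi> f = q * (\<chi> \<nu> - \<chi> \<mu>)"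
    using Q_fraction_value[OF i \<chi> reg] by blast
  let ?H = "ZH 0 (refl S i)"
  have "ZH \<kappa> id * (?H * x - scale q x) - scale (\<chi> (refl S i \<kappa>)) (?H * x - scale q x) \<in> J" for \<kappa>
  proof -
    let ?\<nu> = "refl S i \<kappa>"
    \<comment> \<open>The relation is used at the exponent \<open>r_i \<kappa>\<close>, so that
      \<open>Z^\<kappa>\<close> appears on the left of \<open>H\<close>.\<close>
    obtain f where f: "Fract f 1 = Q_fraction S \<sigma> \<sigma>' i * Fract (monomial 1 ?\<nu> - monomial 1 \<kappa>) 1"
      and comm: "?H * ZH ?\<nu> id - ZH \<kappa> id * ?H = algebra_embed scale ZH f"
      using bernstein[OF i, of ?\<nu>] by (auto simp: refl_involution[OF i])
    define e where "e = algebra_embed scale ZH f * x - scale (eval_at \<chi> f) x"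
    define d where "d \<kappa> = ZH \<kappa> id * x - scale (\<chi> \<kappa>) x" for \<kappa>
    have mem: "e \<in> J" "d \<kappa> \<in> J" for \<kappa>
      using weight_vector_algebra_embed[OF J x] x by (auto simp: e_def d_def weight_vector_def)
    have "ZH \<kappa> id * ?H = ?H * ZH ?\<nu> id - algebra_embed scale ZH f"
      using comm by (simp add: algebra_simps)
    then have "ZH \<kappa> id * (?H * x - scale q x)
        = ?H * (ZH ?\<nu> id * x) - algebra_embed scale ZH f * x - scale q (ZH \<kappa> id * x)"
      by (simp add: right_diff_distrib left_diff_distrib mult_scale_right flip: mult.assoc)
    \<comment> \<open>Up to elements of \<open>J\<close>, the coefficients of \<open>x\<close> add
      up to \<open>- q \<chi>(\<nu>)\<close>: the part \<open>q \<chi>(\<kappa>)\<close> from the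
      value of \<open>f\<close> cancels that from subtracting \<open>q x\<close>. This is why
      \<open>q\<close> is the right constant.\<close>
    also have "\<dots> = ?H * d ?\<nu> + scale (\<chi> ?\<nu>) (?H * x) - e
        - scale (q * (\<chi> ?\<nu> - \<chi> \<kappa>)) x - scale q (d \<kappa>) - scale (q * \<chi> \<kappa>) x"
      by (simp add: d_def e_def q[OF f] right_diff_distrib mult_scale_right scale_right_diff_distrib)
    finally have "ZH \<kappa> id * (?H * x - scale q x) - scale (\<chi> ?\<nu>) (?H * x - scale q x)
        = ?H * d ?\<nu> - e - scale q (d \<kappa>)"
      by (simp add: scale_right_diff_distrib right_diff_distrib scale_left_diff_distrib mult.commute
          algebra_simps)
    also have "\<dots> \<in> J"
      using mem J by (intro left_ideal_diff left_ideal_scale J) (simp_all add: left_ideal_def)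
    finally show ?thesis .
  qed
  then show ?thesis by (auto simp: weight_vector_def)
qed

text \<open>In contrast to \<open>filtration\<close>, no powers of \<open>Z\<close> occur: the
  subtracted values are constants, so the constructed vector stays in the span of the
  \<open>H_w\<close>, where the coefficient functional is known.\<close>

definition H_filtration :: "nat \<Rightarrow> 'h set"
  where "H_filtration n = span {ZH 0 w | w. w \<in> weyl S \<and> weyl_length S w < n}"

lemma H_in_H_filtration: "w \<in> weyl S \<Longrightarrow> weyl_length S w < n \<Longrightarrow> ZH 0 w \<in> H_filtration n"
  unfolding H_filtration_def by (intro span_base) blast

lemma H_filtration_Suc: "x \<in> H_filtration n \<Longrightarrow> x \<in> H_filtration (Suc n)"
  unfolding H_filtration_def
  by (erule subsetD[OF span_mono, rotated]) (blast intro: less_SucI)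

lemma H_mult_H_filtration:
  assumes i: "i \<in> index_set S" and x: "x \<in> H_filtration n"
  shows "ZH 0 (refl S i) * x \<in> H_filtration (Suc n)"
  using x unfolding H_filtration_def[of n]
proof (induction rule: span_induct_alt)
  case base
  then show ?case by (simp add: H_filtration_def span_zero)
next
  case (step c x y)
  then obtain w where w: "x = ZH 0 w" "w \<in> weyl S" "weyl_length S w < n" by blast
  obtain a where "ZH 0 (refl S i) * ZH 0 w = ZH 0 (refl S i \<circ> w) + scale a (ZH 0 w)"
    using H_mult_H[OF i w(2)] by blast
  moreover have "ZH 0 (refl S i \<circ> w) \<in> H_filtration (Suc n)" "ZH 0 w \<in> H_filtration (Suc n)"
    using w weyl_length_refl_comp[OF i w(2)] refl_comp_in_weyl[OF i w(2)]
    by (auto intro!: H_in_H_filtration)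
  ultimately have "ZH 0 (refl S i) * x \<in> H_filtration (Suc n)"
    using w(1) by (simp add: H_filtration_def span_add span_scale)
  then show ?case
    using step by (simp add: distrib_left mult_scale_right H_filtration_def span_add span_scale)
qed

lemma torus_comp: "\<tau> \<in> torus \<Longrightarrow> additive w \<Longrightarrow> \<tau> \<circ> w \<in> torus"
  by (simp add: torus_def additive.add)

text \<open>The word is built from its right end, starting with \<open>1\<close>, of weight
  \<open>\<tau>\<close>. When letter \<open>j\<close> is added to \<open>ys\<close>, the current
  weight is \<open>\<tau>\<close> composed with \<open>word (rev ys)\<close>, exactly where
  nonsingularity is assumed.\<close>

lemma ex_weight_vector:
  assumes \<tau>: "\<tau> \<in> torus"
  shows "set js \<subseteq> index_set S \<Longrightarrow> weyl_length S (word js) = length js \<Longrightarrow>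
    (\<forall>xs j ys. js = xs @ j # ys \<longrightarrow> \<not> singular j (\<tau> (word (rev ys) (coroot S j)))) \<Longrightarrow>
    \<exists>v. weight_vector (weight_ideal \<tau>) (\<tau> \<circ> word (rev js)) v
      \<and> v - ZH 0 (word js) \<in> H_filtration (length js)"
proof (induction js)
  case Nil
  have "weight_vector (weight_ideal \<tau>) \<tau> 1"
    using generator_in_weight_ideal[of 1] by (simp add: weight_vector_def)
  moreover have "1 - ZH 0 id \<in> H_filtration 0"
    by (simp add: ZH_id_one H_filtration_def span_zero)
  ultimately show ?case by (intro exI[of _ 1]) (simp add: id_def)
next
  case (Cons j js)
  have I: "j \<in> index_set S" "set js \<subseteq> index_set S" using Cons.prems by auto
  note red = reduced_Cons[OF Cons.prems(1,2)]
  have "\<forall>xs k ys. js = xs @ k # ys \<longrightarrow> \<not> singular k (\<tau> (word (rev ys) (coroot S k)))"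
    using Cons.prems(3) by (metis append_Cons)
  then obtain v where v: "weight_vector (weight_ideal \<tau>) (\<tau> \<circ> word (rev js)) v"
    and low: "v - ZH 0 (word js) \<in> H_filtration (length js)"
    using Cons.IH I(2) red(1) by blast
  have "\<not> singular j ((\<tau> \<circ> word (rev js)) (coroot S j))"
    using Cons.prems(3) by auto
  then obtain q where q: "weight_vector (weight_ideal \<tau>) (\<tau> \<circ> word (rev js) \<circ> refl S j)
      (ZH 0 (refl S j) * v - scale q v)"
    using weight_vector_intertwine[OF left_ideal_weight_ideal I(1) torus_comp[OF \<tau> additive_word] _ v]
    by blast
  have "\<tau> \<circ> word (rev js) \<circ> refl S j = \<tau> \<circ> word (rev (j # js))"
    by (simp add: word_append comp_assoc)
  moreover have "ZH 0 (refl S j) * v - scale q v - ZH 0 (word (j # js)) \<in> H_filtration (Suc (length js))"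
  proof -
    have "ZH 0 (refl S j) * v - scale q v - ZH 0 (word (j # js))
        = ZH 0 (refl S j) * (v - ZH 0 (word js)) - (scale q (v - ZH 0 (word js)) + scale q (ZH 0 (word js)))"
      by (simp only: right_diff_distrib red(2) scale_right_diff_distrib) (simp add: algebra_simps)
    moreover have "ZH 0 (word js) \<in> H_filtration (Suc (length js))"
      using red(1) word_in_weyl[OF I(2)] by (intro H_in_H_filtration) auto
    ultimately show ?thesis
      using H_mult_H_filtration[OF I(1) low] H_filtration_Suc[OF low]
      by (simp add: H_filtration_def span_add span_scale span_diff)
  qed
  ultimately show ?case using q by (intro exI[of _ "ZH 0 (refl S j) * v - scale q v"]) (simp add: comp_def)
qed

theorem principal_series_reducible:
  assumes \<tau>: "\<tau> \<in> torus" and ne: "weyl_stabilizer S \<tau> \<noteq> reflection_subgroup S \<sigma> \<sigma>' \<tau>"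
  shows "reducible_module (principal_series scale ZH \<tau>) (tensor_relations scale ZH \<tau>) (+)
    (principal_series_act scale ZH \<tau>)"
proof -
  let ?J = "weight_ideal \<tau>"
  have J: "left_ideal ?J" by (rule left_ideal_weight_ideal)
  obtain js where js: "set js \<subseteq> index_set S" "word js \<in> weyl_stabilizer S \<tau>" "js \<noteq> []"
    "weyl_length S (word js) = length js"
    "\<forall>xs j ys. js = xs @ j # ys \<longrightarrow> \<not> singular j (\<tau> (word (rev ys) (coroot S j)))"
    using ex_nonsingular_word[OF \<tau> ne] by blast
  obtain v where v: "weight_vector ?J (\<tau> \<circ> word (rev js)) v"
    and low: "v - ZH 0 (word js) \<in> H_filtration (length js)"
    using ex_weight_vector[OF \<tau> js(1,4,5)] by blast
  have "\<tau> (word (rev js) \<nu>) = \<tau> \<nu>" for \<nu>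
    using js(2) word_rev'[OF js(1), of \<nu>] unfolding weyl_stabilizer_iff by metis
  then have "\<tau> \<circ> word (rev js) = \<tau>" by auto
  with v have v: "ZH \<kappa> id * v - scale (\<tau> \<kappa>) v \<in> ?J" for \<kappa>
    by (simp add: weight_vector_def)
  \<comment> \<open>Right multiplication by \<open>v\<close> descends to the quotient because
    \<open>v\<close> has weight \<open>\<tau>\<close>, the weight of \<open>1\<close>.\<close>
  have Jv: "x * v \<in> ?J" if "x \<in> ?J" for x
    using that
  proof (induction rule: weight_ideal_induct)
    case (generator h \<kappa>)
    have "h * (ZH \<kappa> id - scale (\<tau> \<kappa>) 1) * v = h * (ZH \<kappa> id * v - scale (\<tau> \<kappa>) v)"
      by (simp add: left_diff_distrib mult_scale_left mult.assoc)
    then show ?case using v J by (simp add: left_ideal_def)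
  qed (use J left_ideal_scale[OF J] in \<open>simp_all add: left_ideal_def distrib_right mult_scale_left\<close>)
  obtain \<Theta> where \<Theta>: "Vector_Spaces.linear scale scale \<Theta>" "\<And>x. x \<in> ?J \<Longrightarrow> \<Theta> x = 0"
    "\<And>u. u \<in> weyl S \<Longrightarrow> \<Theta> (ZH 0 u) = (if u = word js then 1 else 0)"
    using ex_coefficient_functional[OF \<tau>] by blast
  interpret \<Theta>: Vector_Spaces.linear scale scale \<Theta> by (rule \<Theta>(1))
  have "\<Theta> x = 0" if "x \<in> H_filtration (length js)" for x
    using that unfolding H_filtration_def
  proof (induction rule: span_induct_alt)
    case (step c x y)
    then have "\<Theta> x = 0" using \<Theta>(3) js(4) by fastforce
    then show ?case using step by (simp add: \<Theta>.add \<Theta>.scale)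
  qed simp
  \<comment> \<open>The functional takes the value \<open>1\<close> at \<open>v\<close> and
    \<open>0\<close> at \<open>1\<close>, since a nonempty reduced word is not the identity; it
    kills the ideal, so no \<open>v - c\<close> can lie there.\<close>
  then have "\<Theta> v = 1"
    using \<Theta>.diff[of v "ZH 0 (word js)"] low \<Theta>(3)[OF word_in_weyl[OF js(1)]] by simp
  moreover have "\<Theta> 1 = 0"
  proof -
    have "word js \<noteq> id" using js(3,4) weyl_length_id by auto
    then show ?thesis using \<Theta>(3)[OF id_in_weyl] by (simp add: ZH_id_one)
  qed
  ultimately have nonscalar: "v - scale c 1 \<notin> ?J" for c
    using \<Theta>(2)[of "v - scale c 1"] by (auto simp: \<Theta>.diff \<Theta>.scale)
  have "countable ((\<lambda>(\<nu>, w). ZH \<nu> w) ` (UNIV \<times> weyl S))"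
    by (intro countable_image countable_SIGMA countable_free_ab_group countable_weyl)
  then obtain L where "left_ideal L" "?J \<subset> L" "L \<noteq> UNIV"
    using not_maximal_if_nonscalar_endomorphism[OF J _ basis_span Jv nonscalar] by blast
  then show ?thesis
    using J weight_ideal_balanced by (rule reducible_if_intermediate_left_ideal)
qed

end

theorem proposition4p17:
  fixes S :: "('i, 'x::free_ab_group_fin_rank, 'y::free_ab_group_fin_rank) root_datum"
    and \<sigma> \<sigma>' :: "'i \<Rightarrow> complex"
    and scale :: "complex \<Rightarrow> 'h::ring_1 \<Rightarrow> 'h"
    and ZH :: "'y \<Rightarrow> ('y \<Rightarrow> 'y) \<Rightarrow> 'h"
    and \<tau> :: "'y \<Rightarrow> complex"
  assumes "bernstein_lusztig_hecke S \<sigma> \<sigma>' scale ZH"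
    and "\<tau> \<in> torus"
    and "weyl_stabilizer S \<tau> \<noteq> reflection_subgroup S \<sigma> \<sigma>' \<tau>"
  shows "reducible_module (principal_series scale ZH \<tau>) (tensor_relations scale ZH \<tau>) (+)
    (principal_series_act scale ZH \<tau>)"
  using bernstein_lusztig_hecke.principal_series_reducible[OF assms] .

end
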